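(* Let $I$ be the pullback shape category $\{\bullet\to\bullet\leftarrow\bullet\}$. Let $\mathcal{A}$ be the $2$-category generated by objects $X,L,A,B,C$; morphisms $f,g\colon X\to L$, $\lambda_0\colon L\to B$, $\lambda_1\colon L\to C$, $b\colon B\to A$, $c\colon C\to A$; and $2$-morphisms $\gamma_0\colon\lambda_0 f\Rightarrow\lambda_0 g$ and $\gamma_1\colon\lambda_1 f\Rightarrow\lambda_1 g$; subject to the relations $b\lambda_0=c\lambda_1$ and $b*\gamma_0=c*\gamma_1$. Let $F\colon I\to\mathcal{A}$ be the diagram $B\xrightarrow{b}A\xleftarrow{c}C$, and let $\lambda\colon\Delta L\Rightarrow F$ be the $2$-cone with components $\lambda_0$ at $B$, $\lambda_1$ at $C$ and $b\lambda_0=c\lambda_1$ at $A$. Then $(L,\lambda)$ is $2$-terminal in the strict-slice $\Delta\downarrow_s F$ of $2$-cones over $F$, but the functor $\lambda_*\circ\Delta\colon\mathcal{A}(X,L)\to[I,\mathcal{A}](\Delta X,F)$ given by post-composition with $\lambda$ is not surjective on morphisms; i.e. $(L,\lambda)$ is not a $2$-limit of $F$.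
   Context: $2$-categories and $2$-functors are strict; $*$ denotes horizontal composition (and whiskering) of $2$-morphisms and juxtaposition denotes vertical composition. "Generated by the data subject to relations" means the $2$-category freely generated by the listed objects, morphisms and $2$-morphisms, modulo the listed relations. The $1$-category $I$ is regarded as a $2$-category with only identity $2$-morphisms. A $2$-natural transformation $\mu\colon F\Rightarrow G$ between $2$-functors $F,G\colon I\to\mathcal{A}$ consists of morphisms $\mu_i\colon Fi\to Gi$ with $(Gf)\mu_i=\mu_j(Ff)$ for every $f\colon i\to j$ in $I$ and $G\alpha*\mu_i=\mu_j*F\alpha$ for every $2$-morphism $\alpha$ in $I$. A modification $\varphi\colon\mu\to\nu$ consists of $2$-morphisms $\varphi_i\colon\mu_i\Rightarrow\nu_i$ with $Gf*\varphi_i=\varphi_j*Ff$ for every $f\colon i\to j$. $[I,\mathcal{A}]$ is the $2$-category of $2$-functors, $2$-natural transformations and modifications; $\Delta X$ is the constant $2$-functor at $X$; a $2$-cone over $F$ is a $2$-natural transformation $\Delta X\Rightarrow F$. A $2$-limit of $F$ is a pair $(L,\lambda\colon\Delta L\Rightarrow F)$ with $\lambda$ a $2$-cone such that for each $X\in\mathcal{A}$ the functor $\lambda_*\circ\Delta\colon\mathcal{A}(X,L)\to[I,\mathcal{A}](\Delta X,F)$ is an isomorphism of categories. The strict-slice $\Delta\downarrow_s F$ is the $2$-category whose objects are pairs $(X,\mu)$ with $\mu\colon\Delta X\Rightarrow F$ a $2$-cone; morphisms $(X,\mu)\to(Y,\nu)$ are morphisms $f\colon X\to Y$ of $\mathcal{A}$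 with $\nu\Delta f=\mu$; $2$-morphisms $f\Rightarrow g$ are $2$-morphisms $\alpha\colon f\Rightarrow g$ of $\mathcal{A}$ with $\nu*\Delta\alpha=\mathrm{id}_\mu$. An object $L$ of a $2$-category $\mathcal{B}$ is $2$-terminal if for all $X\in\mathcal{B}$ the category $\mathcal{B}(X,L)$ is isomorphic to the terminal category $\mathbb{1}$. *)

theory Defs
  imports Main "HOL-Library.FuncSet"
begin

section \<open>Categories and functors\<close>

record ('o, 'm) cat =
  Obj :: "'o set"
  Arr :: "'m set"
  Dom :: "'m \<Rightarrow> 'o"
  Cod :: "'m \<Rightarrow> 'o"
  Ide :: "'o \<Rightarrow> 'm"
  Cmp :: "'m \<Rightarrow> 'm \<Rightarrow> 'm"

text \<open>Compositions are written in applicative order throughout: \<open>Cmp C g f\<close> is ``first f, then g''.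
  Operations on arrows and cells are only meaningful on composable arguments.\<close>

locale category =
  fixes C :: "('o, 'm) cat"
  assumes Dom_in: "f \<in> Arr C \<Longrightarrow> Dom C f \<in> Obj C"
    and Cod_in: "f \<in> Arr C \<Longrightarrow> Cod C f \<in> Obj C"
    and Ide_in: "x \<in> Obj C \<Longrightarrow> Ide C x \<in> Arr C"
    and Dom_Ide: "x \<in> Obj C \<Longrightarrow> Dom C (Ide C x) = x"
    and Cod_Ide: "x \<in> Obj C \<Longrightarrow> Cod C (Ide C x) = x"
    and Cmp_in: "\<lbrakk>f \<in> Arr C; g \<in> Arr C; Dom C g = Cod C f\<rbrakk> \<Longrightarrow> Cmp C g f \<in> Arr C"
    and Dom_Cmp: "\<lbrakk>f \<in> Arr C; g \<in> Arr C; Dom C g = Cod C f\<rbrakk> \<Longrightarrow> Dom C (Cmp C g f) = Dom C f"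
    and Cod_Cmp: "\<lbrakk>f \<in> Arr C; g \<in> Arr C; Dom C g = Cod C f\<rbrakk> \<Longrightarrow> Cod C (Cmp C g f) = Cod C g"
    and Cmp_Ide_left: "f \<in> Arr C \<Longrightarrow> Cmp C (Ide C (Cod C f)) f = f"
    and Cmp_Ide_right: "f \<in> Arr C \<Longrightarrow> Cmp C f (Ide C (Dom C f)) = f"
    and Cmp_assoc: "\<lbrakk>f \<in> Arr C; g \<in> Arr C; h \<in> Arr C; Dom C g = Cod C f; Dom C h = Cod C g\<rbrakk>
      \<Longrightarrow> Cmp C h (Cmp C g f) = Cmp C (Cmp C h g) f"

record ('o1, 'm1, 'o2, 'm2) funct =
  onObj :: "'o1 \<Rightarrow> 'o2"
  onArr :: "'m1 \<Rightarrow> 'm2"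

definition is_functor :: "('o1, 'm1) cat \<Rightarrow> ('o2, 'm2) cat \<Rightarrow> ('o1, 'm1, 'o2, 'm2) funct \<Rightarrow> bool" where
  "is_functor C D T \<longleftrightarrow> category C \<and> category D
     \<and> (\<forall>x\<in>Obj C. onObj T x \<in> Obj D)
     \<and> (\<forall>f\<in>Arr C. onArr T f \<in> Arr D
          \<and> Dom D (onArr T f) = onObj T (Dom C f) \<and> Cod D (onArr T f) = onObj T (Cod C f))
     \<and> (\<forall>x\<in>Obj C. onArr T (Ide C x) = Ide D (onObj T x))
     \<and> (\<forall>f\<in>Arr C. \<forall>g\<in>Arr C. Dom C g = Cod C f
          \<longrightarrow> onArr T (Cmp C g f) = Cmp D (onArr T g) (onArr T f))"

definition functor_comp ::
  "('o2, 'm2, 'o3, 'm3) funct \<Rightarrow> ('o1, 'm1, 'o2, 'm2) funct \<Rightarrow> ('o1, 'm1, 'o3, 'm3) funct" where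
  "functor_comp S T = \<lparr>onObj = onObj S \<circ> onObj T, onArr = onArr S \<circ> onArr T\<rparr>"

definition is_iso_functor ::
  "('o1, 'm1) cat \<Rightarrow> ('o2, 'm2) cat \<Rightarrow> ('o1, 'm1, 'o2, 'm2) funct \<Rightarrow> bool" where
  "is_iso_functor C D T \<longleftrightarrow> is_functor C D T \<and>
     (\<exists>S. is_functor D C S
        \<and> (\<forall>x\<in>Obj C. onObj S (onObj T x) = x) \<and> (\<forall>f\<in>Arr C. onArr S (onArr T f) = f)
        \<and> (\<forall>y\<in>Obj D. onObj T (onObj S y) = y) \<and> (\<forall>g\<in>Arr D. onArr T (onArr S g) = g))"

definition isomorphic_cats :: "('o1, 'm1) cat \<Rightarrow> ('o2, 'm2) cat \<Rightarrow> bool" where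
  "isomorphic_cats C D \<longleftrightarrow> (\<exists>T. is_iso_functor C D T)"

definition terminal_cat :: "(unit, unit) cat" where
  "terminal_cat = \<lparr>Obj = UNIV, Arr = UNIV, Dom = (\<lambda>_. ()), Cod = (\<lambda>_. ()),
     Ide = (\<lambda>_. ()), Cmp = (\<lambda>_ _. ())\<rparr>"

definition surjective_on_arrows ::
  "('o1, 'm1) cat \<Rightarrow> ('o2, 'm2) cat \<Rightarrow> ('o1, 'm1, 'o2, 'm2) funct \<Rightarrow> bool" where
  "surjective_on_arrows C D T \<longleftrightarrow> (\<forall>g\<in>Arr D. \<exists>f\<in>Arr C. onArr T f = g)"


section \<open>Strict 2-categories\<close>

record ('o, 'm, 't) twocat =
  Ob :: "'o set"
  Mor :: "'m set"
  Cell :: "'t set"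
  src :: "'m \<Rightarrow> 'o"
  trg :: "'m \<Rightarrow> 'o"
  dom2 :: "'t \<Rightarrow> 'm"
  cod2 :: "'t \<Rightarrow> 'm"
  idm :: "'o \<Rightarrow> 'm"
  comp1 :: "'m \<Rightarrow> 'm \<Rightarrow> 'm" (infixl "\<odot>\<index>" 70)
  idc :: "'m \<Rightarrow> 't"
  vcomp :: "'t \<Rightarrow> 't \<Rightarrow> 't" (infixl "\<bullet>\<index>" 70)
  hcomp :: "'t \<Rightarrow> 't \<Rightarrow> 't" (infixl "\<star>\<index>" 70)

definition cat1 :: "('o, 'm, 't) twocat \<Rightarrow> ('o, 'm) cat" where
  "cat1 A = \<lparr>Obj = Ob A, Arr = Mor A, Dom = src A, Cod = trg A, Ide = idm A, Cmp = comp1 A\<rparr>"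

definition vcat :: "('o, 'm, 't) twocat \<Rightarrow> ('m, 't) cat" where
  "vcat A = \<lparr>Obj = Mor A, Arr = Cell A, Dom = dom2 A, Cod = cod2 A, Ide = idc A, Cmp = vcomp A\<rparr>"

definition hcat :: "('o, 'm, 't) twocat \<Rightarrow> ('o, 't) cat" where
  "hcat A = \<lparr>Obj = Ob A, Arr = Cell A, Dom = (\<lambda>\<alpha>. src A (dom2 A \<alpha>)), Cod = (\<lambda>\<alpha>. trg A (dom2 A \<alpha>)),
     Ide = (\<lambda>x. idc A (idm A x)), Cmp = hcomp A\<rparr>"

locale two_category =
  fixes A :: "('o, 'm, 't) twocat" (structure)
  assumes cat1: "category (cat1 A)"
    and vcat: "category (vcat A)"
    and hcat: "category (hcat A)"
    and src_parallel: "\<alpha> \<in> Cell A \<Longrightarrow> src A (cod2 A \<alpha>) = src A (dom2 A \<alpha>)"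
    and trg_parallel: "\<alpha> \<in> Cell A \<Longrightarrow> trg A (cod2 A \<alpha>) = trg A (dom2 A \<alpha>)"
    and dom2_hcomp: "\<lbrakk>\<alpha> \<in> Cell A; \<beta> \<in> Cell A; src A (dom2 A \<beta>) = trg A (dom2 A \<alpha>)\<rbrakk>
      \<Longrightarrow> dom2 A (\<beta> \<star> \<alpha>) = dom2 A \<beta> \<odot> dom2 A \<alpha>"
    and cod2_hcomp: "\<lbrakk>\<alpha> \<in> Cell A; \<beta> \<in> Cell A; src A (dom2 A \<beta>) = trg A (dom2 A \<alpha>)\<rbrakk>
      \<Longrightarrow> cod2 A (\<beta> \<star> \<alpha>) = cod2 A \<beta> \<odot> cod2 A \<alpha>"
    and hcomp_idc: "\<lbrakk>f \<in> Mor A; g \<in> Mor A; src A g = trg A f\<rbrakk>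
      \<Longrightarrow> idc A g \<star> idc A f = idc A (g \<odot> f)"
    and interchange: "\<lbrakk>\<alpha> \<in> Cell A; \<alpha>' \<in> Cell A; \<beta> \<in> Cell A; \<beta>' \<in> Cell A;
        dom2 A \<alpha>' = cod2 A \<alpha>; dom2 A \<beta>' = cod2 A \<beta>; src A (dom2 A \<beta>) = trg A (dom2 A \<alpha>)\<rbrakk>
      \<Longrightarrow> (\<beta>' \<bullet> \<beta>) \<star> (\<alpha>' \<bullet> \<alpha>) = (\<beta>' \<star> \<alpha>') \<bullet> (\<beta> \<star> \<alpha>)"

definition hom_cat :: "('o, 'm, 't) twocat \<Rightarrow> 'o \<Rightarrow> 'o \<Rightarrow> ('m, 't) cat" where
  "hom_cat A x y =
     \<lparr>Obj = {f \<in> Mor A. src A f = x \<and> trg A f = y},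
      Arr = {\<alpha> \<in> Cell A. src A (dom2 A \<alpha>) = x \<and> trg A (dom2 A \<alpha>) = y},
      Dom = dom2 A, Cod = cod2 A, Ide = idc A, Cmp = vcomp A\<rparr>"

definition postcomp :: "('o, 'm, 't) twocat \<Rightarrow> 'm \<Rightarrow> ('m, 't, 'm, 't) funct" where
  "postcomp A h = \<lparr>onObj = (\<lambda>f. h \<odot>\<^bsub>A\<^esub> f), onArr = (\<lambda>\<alpha>. idc A h \<star>\<^bsub>A\<^esub> \<alpha>)\<rparr>"

definition locally_discrete :: "('o, 'm) cat \<Rightarrow> ('o, 'm, 'm) twocat" where
  "locally_discrete C =
     \<lparr>Ob = Obj C, Mor = Arr C, Cell = Arr C, src = Dom C, trg = Cod C, dom2 = (\<lambda>f. f), cod2 = (\<lambda>f. f),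
      idm = Ide C, comp1 = Cmp C, idc = (\<lambda>f. f), vcomp = (\<lambda>_ f. f), hcomp = Cmp C\<rparr>"

definition two_terminal :: "('o, 'm, 't) twocat \<Rightarrow> 'o \<Rightarrow> bool" where
  "two_terminal B L \<longleftrightarrow> two_category B \<and> L \<in> Ob B
     \<and> (\<forall>X\<in>Ob B. isomorphic_cats (hom_cat B X L) terminal_cat)"


section \<open>The 2-category of 2-functors, 2-natural transformations and modifications\<close>

text \<open>The underlying functions are required to be extensional (undefined outside the carriers), so
  that HOL equality of these records is equality of 2-functors, 2-natural transformations and
  modifications.\<close>

record ('io, 'im, 'it, 'o, 'm, 't) tfunctor =
  F0 :: "'io \<Rightarrow> 'o"
  F1 :: "'im \<Rightarrow> 'm"
  F2 :: "'it \<Rightarrow> 't"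

definition two_functor ::
  "('io, 'im, 'it) twocat \<Rightarrow> ('o, 'm, 't) twocat \<Rightarrow> ('io, 'im, 'it, 'o, 'm, 't) tfunctor \<Rightarrow> bool" where
  "two_functor I A F \<longleftrightarrow> two_category I \<and> two_category A
     \<and> F0 F \<in> Ob I \<rightarrow>\<^sub>E Ob A \<and> F1 F \<in> Mor I \<rightarrow>\<^sub>E Mor A \<and> F2 F \<in> Cell I \<rightarrow>\<^sub>E Cell A
     \<and> (\<forall>f\<in>Mor I. src A (F1 F f) = F0 F (src I f) \<and> trg A (F1 F f) = F0 F (trg I f))
     \<and> (\<forall>\<alpha>\<in>Cell I. dom2 A (F2 F \<alpha>) = F1 F (dom2 I \<alpha>) \<and> cod2 A (F2 F \<alpha>) = F1 F (cod2 I \<alpha>))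
     \<and> (\<forall>i\<in>Ob I. F1 F (idm I i) = idm A (F0 F i))
     \<and> (\<forall>f\<in>Mor I. \<forall>g\<in>Mor I. src I g = trg I f \<longrightarrow> F1 F (g \<odot>\<^bsub>I\<^esub> f) = F1 F g \<odot>\<^bsub>A\<^esub> F1 F f)
     \<and> (\<forall>f\<in>Mor I. F2 F (idc I f) = idc A (F1 F f))
     \<and> (\<forall>\<alpha>\<in>Cell I. \<forall>\<beta>\<in>Cell I. dom2 I \<beta> = cod2 I \<alpha>
          \<longrightarrow> F2 F (\<beta> \<bullet>\<^bsub>I\<^esub> \<alpha>) = F2 F \<beta> \<bullet>\<^bsub>A\<^esub> F2 F \<alpha>)
     \<and> (\<forall>\<alpha>\<in>Cell I. \<forall>\<beta>\<in>Cell I. src I (dom2 I \<beta>) = trg I (dom2 I \<alpha>)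
          \<longrightarrow> F2 F (\<beta> \<star>\<^bsub>I\<^esub> \<alpha>) = F2 F \<beta> \<star>\<^bsub>A\<^esub> F2 F \<alpha>)"

record ('io, 'im, 'it, 'o, 'm, 't) nattrans =
  ndom :: "('io, 'im, 'it, 'o, 'm, 't) tfunctor"
  ncod :: "('io, 'im, 'it, 'o, 'm, 't) tfunctor"
  ncmpt :: "'io \<Rightarrow> 'm"

definition two_nat ::
  "('io, 'im, 'it) twocat \<Rightarrow> ('o, 'm, 't) twocat \<Rightarrow> ('io, 'im, 'it, 'o, 'm, 't) nattrans \<Rightarrow> bool" where
  "two_nat I A \<mu> \<longleftrightarrow> two_functor I A (ndom \<mu>) \<and> two_functor I A (ncod \<mu>)
     \<and> ncmpt \<mu> \<in> Ob I \<rightarrow>\<^sub>E Mor A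
     \<and> (\<forall>i\<in>Ob I. src A (ncmpt \<mu> i) = F0 (ndom \<mu>) i \<and> trg A (ncmpt \<mu> i) = F0 (ncod \<mu>) i)
     \<and> (\<forall>f\<in>Mor I. F1 (ncod \<mu>) f \<odot>\<^bsub>A\<^esub> ncmpt \<mu> (src I f) = ncmpt \<mu> (trg I f) \<odot>\<^bsub>A\<^esub> F1 (ndom \<mu>) f)
     \<and> (\<forall>\<alpha>\<in>Cell I. F2 (ncod \<mu>) \<alpha> \<star>\<^bsub>A\<^esub> idc A (ncmpt \<mu> (src I (dom2 I \<alpha>)))
          = idc A (ncmpt \<mu> (trg I (dom2 I \<alpha>))) \<star>\<^bsub>A\<^esub> F2 (ndom \<mu>) \<alpha>)"

record ('io, 'im, 'it, 'o, 'm, 't) modif =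
  mdom :: "('io, 'im, 'it, 'o, 'm, 't) nattrans"
  mcod :: "('io, 'im, 'it, 'o, 'm, 't) nattrans"
  mdf :: "'io \<Rightarrow> 't"

definition modification ::
  "('io, 'im, 'it) twocat \<Rightarrow> ('o, 'm, 't) twocat \<Rightarrow> ('io, 'im, 'it, 'o, 'm, 't) modif \<Rightarrow> bool" where
  "modification I A \<phi> \<longleftrightarrow> two_nat I A (mdom \<phi>) \<and> two_nat I A (mcod \<phi>)
     \<and> ndom (mcod \<phi>) = ndom (mdom \<phi>) \<and> ncod (mcod \<phi>) = ncod (mdom \<phi>)
     \<and> mdf \<phi> \<in> Ob I \<rightarrow>\<^sub>E Cell A
     \<and> (\<forall>i\<in>Ob I. dom2 A (mdf \<phi> i) = ncmpt (mdom \<phi>) i \<and> cod2 A (mdf \<phi> i) = ncmpt (mcod \<phi>) i)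
     \<and> (\<forall>f\<in>Mor I. idc A (F1 (ncod (mdom \<phi>)) f) \<star>\<^bsub>A\<^esub> mdf \<phi> (src I f)
          = mdf \<phi> (trg I f) \<star>\<^bsub>A\<^esub> idc A (F1 (ndom (mdom \<phi>)) f))"

definition nat_comp ::
  "('io, 'im, 'it) twocat \<Rightarrow> ('o, 'm, 't) twocat \<Rightarrow> ('io, 'im, 'it, 'o, 'm, 't) nattrans
     \<Rightarrow> ('io, 'im, 'it, 'o, 'm, 't) nattrans \<Rightarrow> ('io, 'im, 'it, 'o, 'm, 't) nattrans" where
  "nat_comp I A \<nu> \<mu> =
     \<lparr>ndom = ndom \<mu>, ncod = ncod \<nu>, ncmpt = (\<lambda>i\<in>Ob I. ncmpt \<nu> i \<odot>\<^bsub>A\<^esub> ncmpt \<mu> i)\<rparr>"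

definition functor_2cat ::
  "('io, 'im, 'it) twocat \<Rightarrow> ('o, 'm, 't) twocat
     \<Rightarrow> (('io, 'im, 'it, 'o, 'm, 't) tfunctor, ('io, 'im, 'it, 'o, 'm, 't) nattrans,
         ('io, 'im, 'it, 'o, 'm, 't) modif) twocat" where
  "functor_2cat I A =
     \<lparr>Ob = {F. two_functor I A F}, Mor = {\<mu>. two_nat I A \<mu>}, Cell = {\<phi>. modification I A \<phi>},
      src = ndom, trg = ncod, dom2 = mdom, cod2 = mcod,
      idm = (\<lambda>F. \<lparr>ndom = F, ncod = F, ncmpt = (\<lambda>i\<in>Ob I. idm A (F0 F i))\<rparr>),
      comp1 = nat_comp I A,
      idc = (\<lambda>\<mu>. \<lparr>mdom = \<mu>, mcod = \<mu>, mdf = (\<lambda>i\<in>Ob I. idc A (ncmpt \<mu> i))\<rparr>),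
      vcomp = (\<lambda>\<psi> \<phi>. \<lparr>mdom = mdom \<phi>, mcod = mcod \<psi>, mdf = (\<lambda>i\<in>Ob I. mdf \<psi> i \<bullet>\<^bsub>A\<^esub> mdf \<phi> i)\<rparr>),
      hcomp = (\<lambda>\<psi> \<phi>. \<lparr>mdom = nat_comp I A (mdom \<psi>) (mdom \<phi>),
                        mcod = nat_comp I A (mcod \<psi>) (mcod \<phi>),
                        mdf = (\<lambda>i\<in>Ob I. mdf \<psi> i \<star>\<^bsub>A\<^esub> mdf \<phi> i)\<rparr>)\<rparr>"


section \<open>2-cones, the strict-slice and 2-limits\<close>

definition Delta0 ::
  "('io, 'im, 'it) twocat \<Rightarrow> ('o, 'm, 't) twocat \<Rightarrow> 'o \<Rightarrow> ('io, 'im, 'it, 'o, 'm, 't) tfunctor" where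
  "Delta0 I A X = \<lparr>F0 = (\<lambda>i\<in>Ob I. X), F1 = (\<lambda>f\<in>Mor I. idm A X), F2 = (\<lambda>\<alpha>\<in>Cell I. idc A (idm A X))\<rparr>"

definition Delta1 ::
  "('io, 'im, 'it) twocat \<Rightarrow> ('o, 'm, 't) twocat \<Rightarrow> 'm \<Rightarrow> ('io, 'im, 'it, 'o, 'm, 't) nattrans" where
  "Delta1 I A f =
     \<lparr>ndom = Delta0 I A (src A f), ncod = Delta0 I A (trg A f), ncmpt = (\<lambda>i\<in>Ob I. f)\<rparr>"

definition Delta2 ::
  "('io, 'im, 'it) twocat \<Rightarrow> ('o, 'm, 't) twocat \<Rightarrow> 't \<Rightarrow> ('io, 'im, 'it, 'o, 'm, 't) modif" where
  "Delta2 I A \<alpha> =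
     \<lparr>mdom = Delta1 I A (dom2 A \<alpha>), mcod = Delta1 I A (cod2 A \<alpha>), mdf = (\<lambda>i\<in>Ob I. \<alpha>)\<rparr>"

definition Delta_hom ::
  "('io, 'im, 'it) twocat \<Rightarrow> ('o, 'm, 't) twocat
     \<Rightarrow> ('m, 't, ('io, 'im, 'it, 'o, 'm, 't) nattrans, ('io, 'im, 'it, 'o, 'm, 't) modif) funct" where
  "Delta_hom I A = \<lparr>onObj = Delta1 I A, onArr = Delta2 I A\<rparr>"

definition two_cone ::
  "('io, 'im, 'it) twocat \<Rightarrow> ('o, 'm, 't) twocat \<Rightarrow> ('io, 'im, 'it, 'o, 'm, 't) tfunctor
     \<Rightarrow> 'o \<Rightarrow> ('io, 'im, 'it, 'o, 'm, 't) nattrans \<Rightarrow> bool" where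
  "two_cone I A F X \<mu> \<longleftrightarrow> X \<in> Ob A \<and> two_nat I A \<mu> \<and> ndom \<mu> = Delta0 I A X \<and> ncod \<mu> = F"

definition cone_functor ::
  "('io, 'im, 'it) twocat \<Rightarrow> ('o, 'm, 't) twocat \<Rightarrow> ('io, 'im, 'it, 'o, 'm, 't) nattrans
     \<Rightarrow> ('m, 't, ('io, 'im, 'it, 'o, 'm, 't) nattrans, ('io, 'im, 'it, 'o, 'm, 't) modif) funct" where
  "cone_functor I A l = functor_comp (postcomp (functor_2cat I A) l) (Delta_hom I A)"

definition is_two_limit ::
  "('io, 'im, 'it) twocat \<Rightarrow> ('o, 'm, 't) twocat \<Rightarrow> ('io, 'im, 'it, 'o, 'm, 't) tfunctor
     \<Rightarrow> 'o \<Rightarrow> ('io, 'im, 'it, 'o, 'm, 't) nattrans \<Rightarrow> bool" where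
  "is_two_limit I A F L l \<longleftrightarrow> two_cone I A F L l
     \<and> (\<forall>X\<in>Ob A. is_iso_functor (hom_cat A X L) (hom_cat (functor_2cat I A) (Delta0 I A X) F)
                    (cone_functor I A l))"

text \<open>Morphisms and 2-morphisms of the strict-slice are tagged with their source and target objects:
  one and the same morphism of the ambient 2-category may underlie several morphisms of the slice.\<close>

definition strict_slice ::
  "('io, 'im, 'it) twocat \<Rightarrow> ('o, 'm, 't) twocat \<Rightarrow> ('io, 'im, 'it, 'o, 'm, 't) tfunctor
     \<Rightarrow> ('o \<times> ('io, 'im, 'it, 'o, 'm, 't) nattrans,
         ('o \<times> ('io, 'im, 'it, 'o, 'm, 't) nattrans) \<times> 'm \<times> ('o \<times> ('io, 'im, 'it, 'o, 'm, 't) nattrans),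
         ('o \<times> ('io, 'im, 'it, 'o, 'm, 't) nattrans) \<times> 't \<times> ('o \<times> ('io, 'im, 'it, 'o, 'm, 't) nattrans))
        twocat" where
  "strict_slice I A F =
     (let cone = {(X, \<mu>). two_cone I A F X \<mu>};
          arrow = {((X, \<mu>), f, (Y, \<nu>)) | X \<mu> f Y \<nu>.
            two_cone I A F X \<mu> \<and> two_cone I A F Y \<nu> \<and> f \<in> Mor A \<and> src A f = X \<and> trg A f = Y
            \<and> \<nu> \<odot>\<^bsub>functor_2cat I A\<^esub> Delta1 I A f = \<mu>};
          cell = {((X, \<mu>), \<alpha>, (Y, \<nu>)) | X \<mu> \<alpha> Y \<nu>.
            \<alpha> \<in> Cell A \<and> ((X, \<mu>), dom2 A \<alpha>, (Y, \<nu>)) \<in> arrow \<and> ((X, \<mu>), cod2 A \<alpha>, (Y, \<nu>)) \<in> arrow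
            \<and> idc (functor_2cat I A) \<nu> \<star>\<^bsub>functor_2cat I A\<^esub> Delta2 I A \<alpha> = idc (functor_2cat I A) \<mu>}
      in \<lparr>Ob = cone, Mor = arrow, Cell = cell,
          src = (\<lambda>(P, f, Q). P), trg = (\<lambda>(P, f, Q). Q),
          dom2 = (\<lambda>(P, \<alpha>, Q). (P, dom2 A \<alpha>, Q)), cod2 = (\<lambda>(P, \<alpha>, Q). (P, cod2 A \<alpha>, Q)),
          idm = (\<lambda>(X, \<mu>). ((X, \<mu>), idm A X, (X, \<mu>))),
          comp1 = (\<lambda>(Q, g, R) (P, f, Q'). (P, g \<odot>\<^bsub>A\<^esub> f, R)),
          idc = (\<lambda>(P, f, Q). (P, idc A f, Q)),
          vcomp = (\<lambda>(P', \<beta>, Q') (P, \<alpha>, Q). (P, \<beta> \<bullet>\<^bsub>A\<^esub> \<alpha>, Q)),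
          hcomp = (\<lambda>(Q, \<beta>, R) (P, \<alpha>, Q'). (P, \<beta> \<star>\<^bsub>A\<^esub> \<alpha>, R))\<rparr>)"


section \<open>2-categories given by generators and relations\<close>

datatype ('o, 'g) mtm = MId 'o | MGen 'g | MComp "('o, 'g) mtm" "('o, 'g) mtm"

datatype ('o, 'g, 'h) ctm =
    CGen 'h
  | CId "('o, 'g) mtm"
  | CV "('o, 'g, 'h) ctm" "('o, 'g, 'h) ctm"
  | CH "('o, 'g, 'h) ctm" "('o, 'g, 'h) ctm"

record ('o, 'g, 'h) presentation =
  gobs :: "'o set"
  gmors :: "'g set"
  gsrc :: "'g \<Rightarrow> 'o"
  gtrg :: "'g \<Rightarrow> 'o"
  mrels :: "(('o, 'g) mtm \<times> ('o, 'g) mtm) set"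
  gcells :: "'h set"
  gdom :: "'h \<Rightarrow> ('o, 'g) mtm"
  gcod :: "'h \<Rightarrow> ('o, 'g) mtm"
  crels :: "(('o, 'g, 'h) ctm \<times> ('o, 'g, 'h) ctm) set"

text \<open>Relations between terms that are not well-formed and parallel are ignored by the congruences
  below.\<close>

primrec msrc :: "('o, 'g, 'h) presentation \<Rightarrow> ('o, 'g) mtm \<Rightarrow> 'o" where
  "msrc P (MId x) = x"
| "msrc P (MGen g) = gsrc P g"
| "msrc P (MComp u t) = msrc P t"

primrec mtrg :: "('o, 'g, 'h) presentation \<Rightarrow> ('o, 'g) mtm \<Rightarrow> 'o" where
  "mtrg P (MId x) = x"
| "mtrg P (MGen g) = gtrg P g"
| "mtrg P (MComp u t) = mtrg P u"

inductive mwf :: "('o, 'g, 'h) presentation \<Rightarrow> ('o, 'g) mtm \<Rightarrow> bool" for P where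
  mwf_Id: "x \<in> gobs P \<Longrightarrow> mwf P (MId x)"
| mwf_Gen: "\<lbrakk>g \<in> gmors P; gsrc P g \<in> gobs P; gtrg P g \<in> gobs P\<rbrakk> \<Longrightarrow> mwf P (MGen g)"
| mwf_Comp: "\<lbrakk>mwf P u; mwf P t; msrc P u = mtrg P t\<rbrakk> \<Longrightarrow> mwf P (MComp u t)"

inductive meq :: "('o, 'g, 'h) presentation \<Rightarrow> ('o, 'g) mtm \<Rightarrow> ('o, 'g) mtm \<Rightarrow> bool" for P where
  meq_refl: "mwf P t \<Longrightarrow> meq P t t"
| meq_sym: "meq P s t \<Longrightarrow> meq P t s"
| meq_trans: "\<lbrakk>meq P s t; meq P t u\<rbrakk> \<Longrightarrow> meq P s u"
| meq_Comp: "\<lbrakk>meq P u u'; meq P t t'; mwf P (MComp u t)\<rbrakk> \<Longrightarrow> meq P (MComp u t) (MComp u' t')"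
| meq_Id_left: "mwf P t \<Longrightarrow> meq P (MComp (MId (mtrg P t)) t) t"
| meq_Id_right: "mwf P t \<Longrightarrow> meq P (MComp t (MId (msrc P t))) t"
| meq_assoc: "mwf P (MComp v (MComp u t)) \<Longrightarrow> meq P (MComp v (MComp u t)) (MComp (MComp v u) t)"
| meq_rel: "\<lbrakk>(s, t) \<in> mrels P; mwf P s; mwf P t; msrc P s = msrc P t; mtrg P s = mtrg P t\<rbrakk>
    \<Longrightarrow> meq P s t"

primrec cdom :: "('o, 'g, 'h) presentation \<Rightarrow> ('o, 'g, 'h) ctm \<Rightarrow> ('o, 'g) mtm" where
  "cdom P (CGen h) = gdom P h"
| "cdom P (CId t) = t"
| "cdom P (CV d c) = cdom P c"
| "cdom P (CH d c) = MComp (cdom P d) (cdom P c)"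

primrec ccod :: "('o, 'g, 'h) presentation \<Rightarrow> ('o, 'g, 'h) ctm \<Rightarrow> ('o, 'g) mtm" where
  "ccod P (CGen h) = gcod P h"
| "ccod P (CId t) = t"
| "ccod P (CV d c) = ccod P d"
| "ccod P (CH d c) = MComp (ccod P d) (ccod P c)"

text \<open>Vertical composability is tested up to the congruence on morphism terms, since the domain and
  codomain of a 2-morphism only matter as elements of the quotient.\<close>

inductive cwf :: "('o, 'g, 'h) presentation \<Rightarrow> ('o, 'g, 'h) ctm \<Rightarrow> bool" for P where
  cwf_Gen: "\<lbrakk>h \<in> gcells P; mwf P (gdom P h); mwf P (gcod P h);
      msrc P (gdom P h) = msrc P (gcod P h); mtrg P (gdom P h) = mtrg P (gcod P h)\<rbrakk> \<Longrightarrow> cwf P (CGen h)"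
| cwf_Id: "mwf P t \<Longrightarrow> cwf P (CId t)"
| cwf_V: "\<lbrakk>cwf P d; cwf P c; meq P (cdom P d) (ccod P c)\<rbrakk> \<Longrightarrow> cwf P (CV d c)"
| cwf_H: "\<lbrakk>cwf P d; cwf P c; msrc P (cdom P d) = mtrg P (cdom P c)\<rbrakk> \<Longrightarrow> cwf P (CH d c)"

inductive ceq :: "('o, 'g, 'h) presentation \<Rightarrow> ('o, 'g, 'h) ctm \<Rightarrow> ('o, 'g, 'h) ctm \<Rightarrow> bool" for P where
  ceq_refl: "cwf P c \<Longrightarrow> ceq P c c"
| ceq_sym: "ceq P c d \<Longrightarrow> ceq P d c"
| ceq_trans: "\<lbrakk>ceq P c d; ceq P d e\<rbrakk> \<Longrightarrow> ceq P c e"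
| ceq_Id: "meq P s t \<Longrightarrow> ceq P (CId s) (CId t)"
| ceq_V: "\<lbrakk>ceq P d d'; ceq P c c'; cwf P (CV d c)\<rbrakk> \<Longrightarrow> ceq P (CV d c) (CV d' c')"
| ceq_H: "\<lbrakk>ceq P d d'; ceq P c c'; cwf P (CH d c)\<rbrakk> \<Longrightarrow> ceq P (CH d c) (CH d' c')"
| ceq_V_Id_left: "cwf P c \<Longrightarrow> ceq P (CV (CId (ccod P c)) c) c"
| ceq_V_Id_right: "cwf P c \<Longrightarrow> ceq P (CV c (CId (cdom P c))) c"
| ceq_V_assoc: "cwf P (CV e (CV d c)) \<Longrightarrow> ceq P (CV e (CV d c)) (CV (CV e d) c)"
| ceq_H_Id_left: "cwf P c \<Longrightarrow> ceq P (CH (CId (MId (mtrg P (cdom P c)))) c) c"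
| ceq_H_Id_right: "cwf P c \<Longrightarrow> ceq P (CH c (CId (MId (msrc P (cdom P c))))) c"
| ceq_H_assoc: "cwf P (CH e (CH d c)) \<Longrightarrow> ceq P (CH e (CH d c)) (CH (CH e d) c)"
| ceq_H_Id: "mwf P (MComp u t) \<Longrightarrow> ceq P (CH (CId u) (CId t)) (CId (MComp u t))"
| ceq_interchange: "cwf P (CH (CV d' d) (CV c' c))
    \<Longrightarrow> ceq P (CH (CV d' d) (CV c' c)) (CV (CH d' c') (CH d c))"
| ceq_rel: "\<lbrakk>(c, d) \<in> crels P; cwf P c; cwf P d; meq P (cdom P c) (cdom P d); meq P (ccod P c) (ccod P d)\<rbrakk>
    \<Longrightarrow> ceq P c d"

definition mcls :: "('o, 'g, 'h) presentation \<Rightarrow> ('o, 'g) mtm \<Rightarrow> ('o, 'g) mtm set" where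
  "mcls P t = {s. meq P t s}"

definition ccls :: "('o, 'g, 'h) presentation \<Rightarrow> ('o, 'g, 'h) ctm \<Rightarrow> ('o, 'g, 'h) ctm set" where
  "ccls P c = {d. ceq P c d}"

abbreviation rep :: "'x set \<Rightarrow> 'x" where
  "rep M \<equiv> (SOME x. x \<in> M)"

definition generated_2cat ::
  "('o, 'g, 'h) presentation \<Rightarrow> ('o, ('o, 'g) mtm set, ('o, 'g, 'h) ctm set) twocat" where
  "generated_2cat P =
     \<lparr>Ob = gobs P, Mor = {mcls P t | t. mwf P t}, Cell = {ccls P c | c. cwf P c},
      src = (\<lambda>M. msrc P (rep M)), trg = (\<lambda>M. mtrg P (rep M)),
      dom2 = (\<lambda>K. mcls P (cdom P (rep K))), cod2 = (\<lambda>K. mcls P (ccod P (rep K))),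
      idm = (\<lambda>x. mcls P (MId x)),
      comp1 = (\<lambda>N M. mcls P (MComp (rep N) (rep M))),
      idc = (\<lambda>M. ccls P (CId (rep M))),
      vcomp = (\<lambda>K J. ccls P (CV (rep K) (rep J))),
      hcomp = (\<lambda>K J. ccls P (CH (rep K) (rep J)))\<rparr>"


section \<open>The example\<close>

datatype cospan_ob = FootL | Apex | FootR
datatype cospan_mor = CospanId cospan_ob | LegL | LegR

primrec cospan_dom :: "cospan_mor \<Rightarrow> cospan_ob" where
  "cospan_dom (CospanId i) = i"
| "cospan_dom LegL = FootL"
| "cospan_dom LegR = FootR"

primrec cospan_cod :: "cospan_mor \<Rightarrow> cospan_ob" where
  "cospan_cod (CospanId i) = i"
| "cospan_cod LegL = Apex"
| "cospan_cod LegR = Apex"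

fun cospan_comp :: "cospan_mor \<Rightarrow> cospan_mor \<Rightarrow> cospan_mor" where
  "cospan_comp (CospanId _) f = f"
| "cospan_comp g (CospanId _) = g"
| "cospan_comp _ _ = undefined"

definition pullback_shape :: "(cospan_ob, cospan_mor) cat" where
  "pullback_shape = \<lparr>Obj = UNIV, Arr = UNIV, Dom = cospan_dom, Cod = cospan_cod,
     Ide = CospanId, Cmp = cospan_comp\<rparr>"

abbreviation shape :: "(cospan_ob, cospan_mor, cospan_mor) twocat" where
  "shape \<equiv> locally_discrete pullback_shape"

datatype gen_ob = obX | obL | obA | obB | obC
datatype gen_mor = gen_f | gen_g | gen_l0 | gen_l1 | gen_b | gen_c
datatype gen_cell = gam0 | gam1

definition ex_pres :: "(gen_ob, gen_mor, gen_cell) presentation" where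
  "ex_pres =
     \<lparr>gobs = UNIV, gmors = UNIV,
      gsrc = (\<lambda>m. case m of gen_f \<Rightarrow> obX | gen_g \<Rightarrow> obX | gen_l0 \<Rightarrow> obL | gen_l1 \<Rightarrow> obL | gen_b \<Rightarrow> obB | gen_c \<Rightarrow> obC),
      gtrg = (\<lambda>m. case m of gen_f \<Rightarrow> obL | gen_g \<Rightarrow> obL | gen_l0 \<Rightarrow> obB | gen_l1 \<Rightarrow> obC | gen_b \<Rightarrow> obA | gen_c \<Rightarrow> obA),
      mrels = {(MComp (MGen gen_b) (MGen gen_l0), MComp (MGen gen_c) (MGen gen_l1))},
      gcells = UNIV,
      gdom = (\<lambda>h. case h of gam0 \<Rightarrow> MComp (MGen gen_l0) (MGen gen_f) | gam1 \<Rightarrow> MComp (MGen gen_l1) (MGen gen_f)),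
      gcod = (\<lambda>h. case h of gam0 \<Rightarrow> MComp (MGen gen_l0) (MGen gen_g) | gam1 \<Rightarrow> MComp (MGen gen_l1) (MGen gen_g)),
      crels = {(CH (CId (MGen gen_b)) (CGen gam0), CH (CId (MGen gen_c)) (CGen gam1))}\<rparr>"

definition exA :: "(gen_ob, (gen_ob, gen_mor) mtm set, (gen_ob, gen_mor, gen_cell) ctm set) twocat" where
  "exA = generated_2cat ex_pres"

abbreviation exMor :: "gen_mor \<Rightarrow> (gen_ob, gen_mor) mtm set" where
  "exMor m \<equiv> mcls ex_pres (MGen m)"

primrec exF0 :: "cospan_ob \<Rightarrow> gen_ob" where
  "exF0 FootL = obB"
| "exF0 Apex = obA"
| "exF0 FootR = obC"

primrec exF1 :: "cospan_mor \<Rightarrow> (gen_ob, gen_mor) mtm set" where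
  "exF1 (CospanId i) = idm exA (exF0 i)"
| "exF1 LegL = exMor gen_b"
| "exF1 LegR = exMor gen_c"

definition exF where
  "exF = \<lparr>F0 = exF0, F1 = exF1, F2 = (\<lambda>f :: cospan_mor. idc exA (exF1 f))\<rparr>"

primrec exlam :: "cospan_ob \<Rightarrow> (gen_ob, gen_mor) mtm set" where
  "exlam FootL = exMor gen_l0"
| "exlam Apex = exMor gen_b \<odot>\<^bsub>exA\<^esub> exMor gen_l0"
| "exlam FootR = exMor gen_l1"

definition exCone where
  "exCone = \<lparr>ndom = Delta0 shape exA obL, ncod = exF, ncmpt = exlam\<rparr>"

end

theory Submission
  imports Defs
begin

text \<open>Every 2-morphism of the presented 2-category whose target is \<open>L\<close> is an identity, because no
  generating 2-morphism ends in \<open>L\<close> or \<open>X\<close> and all morphisms into these objects start in them. So the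
  2-dimensional part of 2-terminality in the slice is automatic, and the modification with
  components \<open>\<gamma>\<^sub>0\<close> and \<open>\<gamma>\<^sub>1\<close> between the distinct cones \<open>\<lambda> f\<close> and \<open>\<lambda> g\<close> is not in the image of
  \<open>\<lambda>\<^sub>* \<circ> \<Delta>\<close>. The cones themselves are classified by decomposing a morphism as a generator after
  another morphism; the set of generators among \<open>f\<close>, \<open>g\<close> occurring in a term is invariant under the
  relations, which separates the morphisms into \<open>L\<close> and excludes the mixed cones \<open>(\<lambda>\<^sub>0 f, \<lambda>\<^sub>1 g)\<close>
  and \<open>(\<lambda>\<^sub>0 g, \<lambda>\<^sub>1 f)\<close>.\<close>

section \<open>Presented 2-categories\<close>

lemma mwf_MId_iff [simp]: "mwf P (MId x) \<longleftrightarrow> x \<in> gobs P"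
  by (auto intro: mwf.intros elim: mwf.cases)

lemma mwf_MComp_iff [simp]:
  "mwf P (MComp u t) \<longleftrightarrow> mwf P u \<and> mwf P t \<and> msrc P u = mtrg P t"
  by (auto intro: mwf.intros elim: mwf.cases)

lemma mwf_endpoints:
  assumes "mwf P t"
  shows "msrc P t \<in> gobs P" "mtrg P t \<in> gobs P"
  using assms by (induction rule: mwf.induct) auto

text \<open>The rules carry well-formedness premises, and \<open>meq_rel\<close> ignores relations
  that are not parallel. Hence source and target descend to the quotient.\<close>

lemma meq_parallel:
  assumes "meq P s t"
  shows "mwf P s \<and> mwf P t \<and> msrc P s = msrc P t \<and> mtrg P s = mtrg P t"
  using assms by (induction rule: meq.induct) (auto simp: mwf_endpoints)

lemma meq_MComp:
  assumes "meq P u u'" "meq P t t'" "msrc P u = mtrg P t"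
  shows "meq P (MComp u t) (MComp u' t')"
  using assms meq_parallel[OF assms(1)] meq_parallel[OF assms(2)] by (intro meq.meq_Comp) auto

lemma cwf_CId_iff [simp]: "cwf P (CId t) \<longleftrightarrow> mwf P t"
  by (auto intro: cwf.intros elim: cwf.cases)

lemma cwf_CV_iff [simp]:
  "cwf P (CV d c) \<longleftrightarrow> cwf P d \<and> cwf P c \<and> meq P (cdom P d) (ccod P c)"
  by (auto intro: cwf.intros elim: cwf.cases)

lemma cwf_CH_iff [simp]:
  "cwf P (CH d c) \<longleftrightarrow> cwf P d \<and> cwf P c \<and> msrc P (cdom P d) = mtrg P (cdom P c)"
  by (auto intro: cwf.intros elim: cwf.cases)

lemma cwf_boundary:
  assumes "cwf P c"
  shows "mwf P (cdom P c) \<and> mwf P (ccod P c)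
    \<and> msrc P (ccod P c) = msrc P (cdom P c) \<and> mtrg P (ccod P c) = mtrg P (cdom P c)"
  using assms by (induction rule: cwf.induct) (auto dest: meq_parallel)

text \<open>Boundaries of congruent 2-morphism terms are only congruent, not equal: the unit and
  associativity rules for horizontal composition change them as morphism terms, and the matching
  rules of \<open>meq\<close> compensate. This makes \<open>dom2\<close> and \<open>cod2\<close>
  well defined on classes.\<close>

lemma ceq_boundary:
  assumes "ceq P c d"
  shows "cwf P c \<and> cwf P d \<and> meq P (cdom P c) (cdom P d) \<and> meq P (ccod P c) (ccod P d)"
  using assms
proof (induction rule: ceq.induct)
  case (ceq_V d d' c c')
  then show ?case by (auto intro: meq.meq_sym meq.meq_trans)
next
  case (ceq_H d d' c c')
  then show ?case
    using meq_parallel[of P "cdom P d" "cdom P d'"] meq_parallel[of P "cdom P c" "cdom P c'"]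
      cwf_boundary[of P d] cwf_boundary[of P c]
    by (auto intro!: meq_MComp)
next
  case (ceq_interchange d' d c' c)
  then show ?case
    using cwf_boundary[of P d] cwf_boundary[of P c] cwf_boundary[of P d'] cwf_boundary[of P c']
      meq_parallel[of P "cdom P d'" "ccod P d"] meq_parallel[of P "cdom P c'" "ccod P c"]
    by (auto intro!: meq_MComp meq.meq_refl)
next
  case (ceq_H_Id_left c)
  then show ?case
    using cwf_boundary[of P c] meq.meq_Id_left[of P "ccod P c"] meq.meq_Id_left[of P "cdom P c"]
    by (auto simp: mwf_endpoints)
next
  case (ceq_H_Id_right c)
  then show ?case
    using cwf_boundary[of P c] meq.meq_Id_right[of P "ccod P c"] meq.meq_Id_right[of P "cdom P c"]
    by (auto simp: mwf_endpoints)
qed (auto simp: mwf_endpoints cwf_boundary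
       intro: meq.intros meq_parallel[THEN conjunct1] meq_parallel[THEN conjunct2, THEN conjunct1])

section \<open>Passage to congruence classes\<close>

lemma mcls_eqI: "meq P s t \<Longrightarrow> mcls P s = mcls P t"
  unfolding mcls_def by (auto intro: meq.meq_trans meq.meq_sym)

lemma mcls_eqD: "mcls P s = mcls P t \<Longrightarrow> mwf P t \<Longrightarrow> meq P s t"
  unfolding mcls_def by (auto intro: meq.meq_refl)

lemma ccls_eqI: "ceq P c d \<Longrightarrow> ccls P c = ccls P d"
  unfolding ccls_def by (auto intro: ceq.ceq_trans ceq.ceq_sym)

lemma ccls_eqD: "ccls P c = ccls P d \<Longrightarrow> cwf P d \<Longrightarrow> ceq P c d"
  unfolding ccls_def by (auto intro: ceq.ceq_refl)

text \<open>The operations of \<open>generated_2cat\<close> act on representatives picked by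
  \<open>rep\<close>. The relation between a term and the picked one lets them be computed on
  arbitrary terms in the rules below.\<close>

lemma meq_rep_mcls: "mwf P t \<Longrightarrow> meq P t (rep (mcls P t))"
  using someI[of "\<lambda>x. x \<in> mcls P t" t] by (simp add: mcls_def meq.meq_refl)

lemma ceq_rep_ccls: "cwf P c \<Longrightarrow> ceq P c (rep (ccls P c))"
  using someI[of "\<lambda>x. x \<in> ccls P c" c] by (simp add: ccls_def ceq.ceq_refl)

lemma generated_2cat_Ob [simp]: "Ob (generated_2cat P) = gobs P"
  and generated_2cat_Mor: "Mor (generated_2cat P) = {mcls P t | t. mwf P t}"
  and generated_2cat_Cell: "Cell (generated_2cat P) = {ccls P c | c. cwf P c}"
  and generated_2cat_idm [simp]: "idm (generated_2cat P) x = mcls P (MId x)"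
  by (simp_all add: generated_2cat_def)

lemma mcls_in_Mor [simp]: "mwf P t \<Longrightarrow> mcls P t \<in> Mor (generated_2cat P)"
  and ccls_in_Cell [simp]: "cwf P c \<Longrightarrow> ccls P c \<in> Cell (generated_2cat P)"
  by (auto simp: generated_2cat_Mor generated_2cat_Cell)

lemma src_mcls [simp]: "mwf P t \<Longrightarrow> src (generated_2cat P) (mcls P t) = msrc P t"
  and trg_mcls [simp]: "mwf P t \<Longrightarrow> trg (generated_2cat P) (mcls P t) = mtrg P t"
  using meq_parallel[OF meq_rep_mcls, of P t] by (auto simp: generated_2cat_def)

lemma dom2_ccls [simp]: "cwf P c \<Longrightarrow> dom2 (generated_2cat P) (ccls P c) = mcls P (cdom P c)"
  and cod2_ccls [simp]: "cwf P c \<Longrightarrow> cod2 (generated_2cat P) (ccls P c) = mcls P (ccod P c)"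
  using ceq_boundary[OF ceq_rep_ccls, of P c]
  by (auto simp: generated_2cat_def dest: mcls_eqI)

lemma comp1_mcls [simp]:
  assumes "mwf P u" "mwf P t" "msrc P u = mtrg P t"
  shows "mcls P u \<odot>\<^bsub>generated_2cat P\<^esub> mcls P t = mcls P (MComp u t)"
  using assms
  by (auto simp: generated_2cat_def intro!: mcls_eqI meq.meq_sym[OF meq_MComp] meq_rep_mcls)

lemma idc_mcls [simp]: "mwf P t \<Longrightarrow> idc (generated_2cat P) (mcls P t) = ccls P (CId t)"
  by (auto simp: generated_2cat_def intro!: ccls_eqI ceq.ceq_Id meq.meq_sym[OF meq_rep_mcls])

lemma vcomp_ccls [simp]:
  assumes "cwf P d" "cwf P c" "meq P (cdom P d) (ccod P c)"
  shows "ccls P d \<bullet>\<^bsub>generated_2cat P\<^esub> ccls P c = ccls P (CV d c)"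
  using assms
  by (auto simp: generated_2cat_def intro!: ccls_eqI ceq.ceq_sym[OF ceq.ceq_V] ceq_rep_ccls)

lemma hcomp_ccls [simp]:
  assumes "cwf P d" "cwf P c" "msrc P (cdom P d) = mtrg P (cdom P c)"
  shows "ccls P d \<star>\<^bsub>generated_2cat P\<^esub> ccls P c = ccls P (CH d c)"
  using assms
  by (auto simp: generated_2cat_def intro!: ccls_eqI ceq.ceq_sym[OF ceq.ceq_H] ceq_rep_ccls)

lemma Mor_generatedE:
  "f \<in> Mor (generated_2cat P) \<Longrightarrow> (\<And>t. mwf P t \<Longrightarrow> f = mcls P t \<Longrightarrow> thesis) \<Longrightarrow> thesis"
  by (auto simp: generated_2cat_Mor)

lemma Cell_generatedE:
  "\<alpha> \<in> Cell (generated_2cat P) \<Longrightarrow> (\<And>c. cwf P c \<Longrightarrow> \<alpha> = ccls P c \<Longrightarrow> thesis) \<Longrightarrow> thesis"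
  by (auto simp: generated_2cat_Cell)

text \<open>On representatives, the unit, associativity and interchange laws are themselves rules of
  \<open>meq\<close> or \<open>ceq\<close>; the work lies in checking that the terms involved are
  composable.\<close>

lemma two_category_generated: "two_category (generated_2cat P)"
proof (rule two_category.intro)
  \<comment> \<open>Classes are sets; without \<open>equalityI\<close>, their equality is proved by
    \<open>mcls_eqI\<close> and \<open>ccls_eqI\<close> instead of by two inclusions.\<close>
  note [rule del] = equalityI
  note [elim!] = Mor_generatedE Cell_generatedE
  note [simp] = mwf_endpoints meq_parallel
  note [dest!] = mcls_eqD
  have bnd: "msrc P (ccod P c) = msrc P (cdom P c)" "mtrg P (ccod P c) = mtrg P (cdom P c)"
    "mwf P (cdom P c)" "mwf P (ccod P c)"
    if "cwf P c" for c
    using cwf_boundary[OF that] by auto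
  show "category (cat1 (generated_2cat P))"
    by unfold_locales
      (auto simp: cat1_def intro!: mcls_eqI meq.meq_Id_left meq.meq_Id_right meq.meq_assoc)
  show "category (vcat (generated_2cat P))"
    by unfold_locales
      (auto simp: vcat_def bnd meq.meq_refl
        intro!: ccls_eqI ceq.ceq_V_Id_left ceq.ceq_V_Id_right ceq.ceq_V_assoc)
  show "category (hcat (generated_2cat P))"
    by unfold_locales
      (auto simp: hcat_def bnd
        intro!: ccls_eqI ceq.ceq_H_Id_left ceq.ceq_H_Id_right ceq.ceq_H_assoc)
  fix \<alpha> assume "\<alpha> \<in> Cell (generated_2cat P)"
  then show "src (generated_2cat P) (cod2 (generated_2cat P) \<alpha>)
      = src (generated_2cat P) (dom2 (generated_2cat P) \<alpha>)"
    and "trg (generated_2cat P) (cod2 (generated_2cat P) \<alpha>)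
      = trg (generated_2cat P) (dom2 (generated_2cat P) \<alpha>)"
    by (auto simp: bnd)
next
  fix \<alpha> \<alpha>' \<beta> \<beta>'
  let ?G = "generated_2cat P"
  assume "\<alpha> \<in> Cell ?G" "\<alpha>' \<in> Cell ?G" "\<beta> \<in> Cell ?G" "\<beta>' \<in> Cell ?G"
    and 1: "dom2 ?G \<alpha>' = cod2 ?G \<alpha>" "dom2 ?G \<beta>' = cod2 ?G \<beta>"
      "src ?G (dom2 ?G \<beta>) = trg ?G (dom2 ?G \<alpha>)"
  then obtain c c' d d' where 2: "cwf P c" "cwf P c'" "cwf P d" "cwf P d'"
    and 3: "\<alpha> = ccls P c" "\<alpha>' = ccls P c'" "\<beta> = ccls P d" "\<beta>' = ccls P d'"
    by (auto simp: generated_2cat_Cell)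
  note bnd = 2[THEN cwf_boundary]
  have 4: "meq P (cdom P c') (ccod P c)" "meq P (cdom P d') (ccod P d)"
    "msrc P (cdom P d) = mtrg P (cdom P c)"
    using 1 2 bnd by (auto simp: 3 dest: mcls_eqD)
  \<comment> \<open>The second pair must be horizontally composable as well; vertical composability
    transports this from the first pair.\<close>
  then have 5: "msrc P (cdom P d') = mtrg P (cdom P c')"
    using bnd by (auto dest!: meq_parallel)
  have "cwf P (CH (CV d' d) (CV c' c))"
    using 2 4 by simp
  from ceq.ceq_interchange[OF this] ceq_boundary[OF this[THEN ceq.ceq_interchange]]
  show "(\<beta>' \<bullet>\<^bsub>?G\<^esub> \<beta>) \<star>\<^bsub>?G\<^esub> (\<alpha>' \<bullet>\<^bsub>?G\<^esub> \<alpha>) = (\<beta>' \<star>\<^bsub>?G\<^esub> \<alpha>') \<bullet>\<^bsub>?G\<^esub> (\<beta> \<star>\<^bsub>?G\<^esub> \<alpha>)"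
    using 2 4 5 by (simp add: 3 ccls_eqI)
qed (auto del: equalityI simp: cwf_boundary meq_parallel dest!: mcls_eqD
     intro!: ccls_eqI ceq.ceq_H_Id elim!: Mor_generatedE Cell_generatedE)

section \<open>Strict 2-categories\<close>

context two_category
begin

interpretation C1: category "cat1 A" by (rule cat1)
interpretation V: category "vcat A" by (rule vcat)
interpretation H: category "hcat A" by (rule hcat)

lemmas mor_simps [simp] =
  C1.Dom_in[unfolded cat1_def cat.simps] C1.Cod_in[unfolded cat1_def cat.simps]
  C1.Ide_in[unfolded cat1_def cat.simps] C1.Dom_Ide[unfolded cat1_def cat.simps]
  C1.Cod_Ide[unfolded cat1_def cat.simps] C1.Cmp_in[unfolded cat1_def cat.simps]
  C1.Dom_Cmp[unfolded cat1_def cat.simps] C1.Cod_Cmp[unfolded cat1_def cat.simps]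
  C1.Cmp_Ide_left[unfolded cat1_def cat.simps] C1.Cmp_Ide_right[unfolded cat1_def cat.simps]

lemmas comp1_assoc = C1.Cmp_assoc[unfolded cat1_def cat.simps]

lemmas cell_simps [simp] =
  V.Dom_in[unfolded vcat_def cat.simps] V.Cod_in[unfolded vcat_def cat.simps]
  V.Ide_in[unfolded vcat_def cat.simps] V.Dom_Ide[unfolded vcat_def cat.simps]
  V.Cod_Ide[unfolded vcat_def cat.simps] V.Cmp_in[unfolded vcat_def cat.simps]
  V.Dom_Cmp[unfolded vcat_def cat.simps] V.Cod_Cmp[unfolded vcat_def cat.simps]
  V.Cmp_Ide_left[unfolded vcat_def cat.simps] V.Cmp_Ide_right[unfolded vcat_def cat.simps]
  src_parallel trg_parallel dom2_hcomp cod2_hcomp hcomp_idc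

lemmas vcomp_assoc = V.Cmp_assoc[unfolded vcat_def cat.simps]

lemmas hcomp_in [simp] = H.Cmp_in[unfolded hcat_def cat.simps]
lemmas hcomp_idm_left = H.Cmp_Ide_left[unfolded hcat_def cat.simps]
lemmas hcomp_idm_right = H.Cmp_Ide_right[unfolded hcat_def cat.simps]
lemmas hcomp_assoc = H.Cmp_assoc[unfolded hcat_def cat.simps]

text \<open>The boundary is a variable fixed by an equation, so that the unit laws rewrite even when
  the object or morphism does not literally have the form \<open>trg A f\<close> or
  \<open>cod2 A \<alpha>\<close>.\<close>

lemma comp1_idm_left [simp]: "f \<in> Mor A \<Longrightarrow> trg A f = y \<Longrightarrow> idm A y \<odot> f = f"
  and comp1_idm_right [simp]: "f \<in> Mor A \<Longrightarrow> src A f = x \<Longrightarrow> f \<odot> idm A x = f"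
  and vcomp_idc_left [simp]: "\<alpha> \<in> Cell A \<Longrightarrow> cod2 A \<alpha> = g \<Longrightarrow> idc A g \<bullet> \<alpha> = \<alpha>"
  and vcomp_idc_right [simp]: "\<alpha> \<in> Cell A \<Longrightarrow> dom2 A \<alpha> = f \<Longrightarrow> \<alpha> \<bullet> idc A f = \<alpha>"
  and hcomp_idm_left' [simp]:
    "\<alpha> \<in> Cell A \<Longrightarrow> trg A (dom2 A \<alpha>) = y \<Longrightarrow> idc A (idm A y) \<star> \<alpha> = \<alpha>"
  and hcomp_idm_right' [simp]:
    "\<alpha> \<in> Cell A \<Longrightarrow> src A (dom2 A \<alpha>) = x \<Longrightarrow> \<alpha> \<star> idc A (idm A x) = \<alpha>"
  using hcomp_idm_left hcomp_idm_right by auto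

text \<open>Interchange with both left factors equal to the identity of \<open>h\<close>, which is
  its own vertical square.\<close>

lemma whisker_left_vcomp:
  assumes "\<alpha> \<in> Cell A" "\<beta> \<in> Cell A" "dom2 A \<beta> = cod2 A \<alpha>" "h \<in> Mor A" "src A h = trg A (dom2 A \<alpha>)"
  shows "idc A h \<star> (\<beta> \<bullet> \<alpha>) = (idc A h \<star> \<beta>) \<bullet> (idc A h \<star> \<alpha>)"
  using interchange[of \<alpha> \<beta> "idc A h" "idc A h"] V.Cmp_Ide_left[of "idc A h"] assms
  by (simp add: vcat_def)

lemma whisker_right_vcomp:
  assumes "\<alpha> \<in> Cell A" "\<beta> \<in> Cell A" "dom2 A \<beta> = cod2 A \<alpha>" "h \<in> Mor A" "trg A h = src A (dom2 A \<alpha>)"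
  shows "(\<beta> \<bullet> \<alpha>) \<star> idc A h = (\<beta> \<star> idc A h) \<bullet> (\<alpha> \<star> idc A h)"
  using interchange[of "idc A h" "idc A h" \<alpha> \<beta>] V.Cmp_Ide_left[of "idc A h"] assms
  by (simp add: vcat_def)

lemma category_hom_cat:
  shows "category (hom_cat A x y)"
  by unfold_locales (auto simp: hom_cat_def vcomp_assoc)

end

lemma two_category_locally_discrete:
  assumes "category C"
  shows "two_category (locally_discrete C)"
proof -
  interpret category C by fact
  show ?thesis
    by (rule two_category.intro; (unfold_locales)?)
      (auto simp: cat1_def vcat_def hcat_def locally_discrete_def
        Dom_in Cod_in Ide_in Dom_Ide Cod_Ide Cmp_in Dom_Cmp Cod_Cmp Cmp_Ide_left Cmp_Ide_right Cmp_assoc)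
qed

text \<open>With one object and one arrow every operation is forced, so the two constant assignments
  are mutually inverse functors.\<close>

lemma isomorphic_cats_terminal:
  assumes "category C" "Obj C = {x}" "Arr C = {a}"
  shows "isomorphic_cats C terminal_cat"
proof -
  interpret category C by fact
  have [simp]: "Dom C a = x" "Cod C a = x" "Ide C x = a" "Cmp C a a = a"
    using Dom_in[of a] Cod_in[of a] Ide_in[of x] Cmp_in[of a a] assms by auto
  have t: "category terminal_cat"
    by unfold_locales (auto simp: terminal_cat_def)
  show ?thesis
    unfolding isomorphic_cats_def is_iso_functor_def
    by (rule exI[of _ "\<lparr>onObj = \<lambda>_. (), onArr = \<lambda>_. ()\<rparr>"], intro conjI
        exI[of _ "\<lparr>onObj = \<lambda>_. x, onArr = \<lambda>_. a\<rparr>"])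
      (use assms t in \<open>auto simp: is_functor_def terminal_cat_def\<close>)
qed

section \<open>2-cones\<close>

lemma two_natD:
  assumes "two_nat I A \<mu>"
  shows "two_category I" "two_category A"
    "two_functor I A (ndom \<mu>)" "two_functor I A (ncod \<mu>)"
    "\<And>i. i \<in> Ob I \<Longrightarrow> ncmpt \<mu> i \<in> Mor A"
    "\<And>i. i \<in> Ob I \<Longrightarrow> src A (ncmpt \<mu> i) = F0 (ndom \<mu>) i"
    "\<And>i. i \<in> Ob I \<Longrightarrow> trg A (ncmpt \<mu> i) = F0 (ncod \<mu>) i"
    "ncmpt \<mu> \<in> extensional (Ob I)"
  using assms by (auto simp: two_nat_def two_functor_def PiE_def)

lemma two_functorD:
  assumes "two_functor I A F"
  shows "two_category I" "two_category A"
    "\<And>i. i \<in> Ob I \<Longrightarrow> F0 F i \<in> Ob A"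
    "\<And>f. f \<in> Mor I \<Longrightarrow> F1 F f \<in> Mor A"
    "\<And>f. f \<in> Mor I \<Longrightarrow> src A (F1 F f) = F0 F (src I f)"
    "\<And>f. f \<in> Mor I \<Longrightarrow> trg A (F1 F f) = F0 F (trg I f)"
    "\<And>\<alpha>. \<alpha> \<in> Cell I \<Longrightarrow> F2 F \<alpha> \<in> Cell A"
    "\<And>\<alpha>. \<alpha> \<in> Cell I \<Longrightarrow> dom2 A (F2 F \<alpha>) = F1 F (dom2 I \<alpha>)"
    "\<And>\<alpha>. \<alpha> \<in> Cell I \<Longrightarrow> cod2 A (F2 F \<alpha>) = F1 F (cod2 I \<alpha>)"
  using assms by (auto simp: two_functor_def PiE_def)

lemma two_functor_Delta0:
  assumes "two_category I" "two_category A" "X \<in> Ob A"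
  shows "two_functor I A (Delta0 I A X)"
proof -
  interpret I: two_category I by fact
  interpret A: two_category A by fact
  have 1: "idm A X \<odot>\<^bsub>A\<^esub> idm A X = idm A X"
    using A.mor_simps(9)[of "idm A X"] assms(3) by simp
  have 2: "idc A (idm A X) \<bullet>\<^bsub>A\<^esub> idc A (idm A X) = idc A (idm A X)"
    using A.cell_simps(9)[of "idc A (idm A X)"] assms(3) by simp
  show ?thesis
    using assms 1 2 by (auto simp: two_functor_def Delta0_def)
qed

section \<open>Modifications and the hom-categories of \<open>functor_2cat\<close>\<close>

lemma functor_2cat_simps:
  "Mor (functor_2cat I A) = {\<mu>. two_nat I A \<mu>}"
  "Cell (functor_2cat I A) = {\<phi>. modification I A \<phi>}"
  "src (functor_2cat I A) = ndom" "trg (functor_2cat I A) = ncod"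
  "dom2 (functor_2cat I A) = mdom" "cod2 (functor_2cat I A) = mcod"
  "mdom (idc (functor_2cat I A) \<mu>) = \<mu>" "mcod (idc (functor_2cat I A) \<mu>) = \<mu>"
  "mdom (\<psi> \<bullet>\<^bsub>functor_2cat I A\<^esub> \<phi>) = mdom \<phi>" "mcod (\<psi> \<bullet>\<^bsub>functor_2cat I A\<^esub> \<phi>) = mcod \<psi>"
  "mdf (\<psi> \<bullet>\<^bsub>functor_2cat I A\<^esub> \<phi>) = (\<lambda>i\<in>Ob I. mdf \<psi> i \<bullet>\<^bsub>A\<^esub> mdf \<phi> i)"
  by (simp_all add: functor_2cat_def)

lemma modification_idc:
  assumes "two_nat I A \<mu>"
  shows "modification I A (idc (functor_2cat I A) \<mu>)"
proof -
  interpret I: two_category I using assms by (rule two_natD)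
  interpret A: two_category A using assms by (rule two_natD)
  note \<mu> = two_natD[OF assms]
  note F = two_functorD[OF \<mu>(3)] two_functorD[OF \<mu>(4)]
  show ?thesis
    using assms by (auto simp: modification_def functor_2cat_def \<mu> F two_nat_def)
qed

lemma modificationD:
  assumes "modification I A \<phi>"
  shows "two_nat I A (mdom \<phi>)" "two_nat I A (mcod \<phi>)"
    "ndom (mcod \<phi>) = ndom (mdom \<phi>)" "ncod (mcod \<phi>) = ncod (mdom \<phi>)"
    "\<And>i. i \<in> Ob I \<Longrightarrow> mdf \<phi> i \<in> Cell A"
    "\<And>i. i \<in> Ob I \<Longrightarrow> dom2 A (mdf \<phi> i) = ncmpt (mdom \<phi>) i"
    "\<And>i. i \<in> Ob I \<Longrightarrow> cod2 A (mdf \<phi> i) = ncmpt (mcod \<phi>) i"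
    "\<And>f. f \<in> Mor I \<Longrightarrow> idc A (F1 (ncod (mdom \<phi>)) f) \<star>\<^bsub>A\<^esub> mdf \<phi> (src I f)
       = mdf \<phi> (trg I f) \<star>\<^bsub>A\<^esub> idc A (F1 (ndom (mdom \<phi>)) f)"
    "mdf \<phi> \<in> extensional (Ob I)"
  using assms by (auto simp: modification_def PiE_def)

text \<open>Whiskering distributes over vertical composition, so the compatibility conditions of the
  two modifications paste.\<close>

lemma modification_vcomp:
  assumes "modification I A \<phi>" "modification I A \<psi>" "mdom \<psi> = mcod \<phi>"
  shows "modification I A (\<psi> \<bullet>\<^bsub>functor_2cat I A\<^esub> \<phi>)"
proof -
  note \<phi> = modificationD[OF assms(1)] and \<psi> = modificationD[OF assms(2)]
  interpret I: two_category I using \<phi>(1) by (rule two_natD)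
  interpret A: two_category A using \<phi>(1) by (rule two_natD)
  note \<mu> = two_natD[OF \<phi>(1)]
  note F = two_functorD(3-)[OF \<mu>(3)] two_functorD(3-)[OF \<mu>(4)]
  show ?thesis
    using assms(3)
    by (auto simp: modification_def functor_2cat_def \<mu> F \<phi> \<psi>
        A.whisker_left_vcomp A.whisker_right_vcomp)
      \<comment> \<open>The condition on \<psi> refers to the functors bounding its own domain; the
        two facts on \<phi> identify them with those bounding the domain of \<phi>.\<close>
      (metis \<psi>(8) \<phi>(3) \<phi>(4))
qed

lemma category_hom_functor_2cat:
  assumes "two_category I" "two_category A"
  shows "category (hom_cat (functor_2cat I A) F G)"
proof -
  interpret A: two_category A by fact
  note [simp] = functor_2cat_simps modificationD(1-7)
  have eq: "\<phi> = \<psi>" if "mdom \<phi> = mdom \<psi>" "mcod \<phi> = mcod \<psi>" "mdf \<phi> = mdf \<psi>"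
    for \<phi> \<psi> :: "('a, 'b, 'c, 'd, 'e, 'f) modif"
    using that by simp
  show ?thesis
  proof (unfold_locales, unfold hom_cat_def cat.simps, goal_cases)
    \<comment> \<open>Goals 9 and 10 are the unit laws, goal 11 is associativity. The unit laws hold
      componentwise on \<open>Ob I\<close>; elsewhere both component functions are undefined, so
      extensionality finishes.\<close>
    case (9 \<phi>)
    then show ?case
      by (intro eq extensionalityI[where A = "Ob I"])
        (auto simp: functor_2cat_def dest: modificationD(9))
  next
    case (10 \<phi>)
    then show ?case
      by (intro eq extensionalityI[where A = "Ob I"])
        (auto simp: functor_2cat_def dest: modificationD(9))
  next
    case (11 \<phi> \<psi> \<chi>)
    then show ?case
      by (auto simp: functor_2cat_def A.vcomp_assoc intro!: restrict_ext)
  qed (auto simp: modification_idc modification_vcomp)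
qed


section \<open>2-cones, modifications between them, and whiskering\<close>

text \<open>\<open>Delta0\<close> sends everything to identities, so one side of each naturality
  condition collapses to a component of the cone. If \<open>I\<close> or \<open>A\<close> is not a
  2-category or \<open>X\<close> is not an object, both sides are false.\<close>

lemma two_cone_iff:
  "two_cone I A F X \<mu> \<longleftrightarrow> two_functor I A F \<and> X \<in> Ob A
     \<and> ndom \<mu> = Delta0 I A X \<and> ncod \<mu> = F \<and> ncmpt \<mu> \<in> Ob I \<rightarrow>\<^sub>E Mor A
     \<and> (\<forall>i\<in>Ob I. src A (ncmpt \<mu> i) = X \<and> trg A (ncmpt \<mu> i) = F0 F i)
     \<and> (\<forall>k\<in>Mor I. F1 F k \<odot>\<^bsub>A\<^esub> ncmpt \<mu> (src I k) = ncmpt \<mu> (trg I k))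
     \<and> (\<forall>\<kappa>\<in>Cell I. F2 F \<kappa> \<star>\<^bsub>A\<^esub> idc A (ncmpt \<mu> (src I (dom2 I \<kappa>)))
          = idc A (ncmpt \<mu> (trg I (dom2 I \<kappa>))))"
  (is "?L \<longleftrightarrow> ?R")
proof (cases "two_category I \<and> two_category A \<and> X \<in> Ob A")
  case True
  then interpret I: two_category I by simp
  interpret A: two_category A using True by simp
  show ?thesis
    using True two_functor_Delta0[of I A X]
    by (auto simp: two_cone_def two_nat_def Delta0_def PiE_iff)
next
  case False
  then show ?thesis
    by (auto simp: two_cone_def two_nat_def two_functor_def)
qed

lemma two_coneD:
  assumes "two_cone I A F X \<mu>"
  shows "two_category I" "two_category A" "two_functor I A F" "X \<in> Ob A"
    "ndom \<mu> = Delta0 I A X" "ncod \<mu> = F"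
    "\<And>i. i \<in> Ob I \<Longrightarrow> ncmpt \<mu> i \<in> Mor A"
    "\<And>i. i \<in> Ob I \<Longrightarrow> src A (ncmpt \<mu> i) = X"
    "\<And>i. i \<in> Ob I \<Longrightarrow> trg A (ncmpt \<mu> i) = F0 F i"
    "\<And>k. k \<in> Mor I \<Longrightarrow> F1 F k \<odot>\<^bsub>A\<^esub> ncmpt \<mu> (src I k) = ncmpt \<mu> (trg I k)"
    "\<And>\<kappa>. \<kappa> \<in> Cell I \<Longrightarrow> F2 F \<kappa> \<star>\<^bsub>A\<^esub> idc A (ncmpt \<mu> (src I (dom2 I \<kappa>)))
       = idc A (ncmpt \<mu> (trg I (dom2 I \<kappa>)))"
    "ncmpt \<mu> \<in> extensional (Ob I)"
  using assms unfolding two_cone_iff by (auto simp: two_functor_def PiE_iff)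

text \<open>Whiskering with the constant diagram is trivial, which leaves one side of the
  compatibility condition as a bare component.\<close>

lemma modification_cones_iff:
  assumes "two_cone I A F X (mdom \<phi>)" "two_cone I A F X (mcod \<phi>)"
  shows "modification I A \<phi> \<longleftrightarrow> mdf \<phi> \<in> Ob I \<rightarrow>\<^sub>E Cell A
     \<and> (\<forall>i\<in>Ob I. dom2 A (mdf \<phi> i) = ncmpt (mdom \<phi>) i \<and> cod2 A (mdf \<phi> i) = ncmpt (mcod \<phi>) i)
     \<and> (\<forall>k\<in>Mor I. idc A (F1 F k) \<star>\<^bsub>A\<^esub> mdf \<phi> (src I k) = mdf \<phi> (trg I k))"
proof -
  note \<mu> = two_coneD[OF assms(1)] and \<nu> = two_coneD[OF assms(2)]
  interpret I: two_category I by (rule \<mu>)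
  interpret A: two_category A by (rule \<mu>)
  have "two_nat I A (mdom \<phi>)" "two_nat I A (mcod \<phi>)"
    using assms by (auto simp: two_cone_def)
  then show ?thesis
    using \<mu> \<nu> by (auto simp: modification_def Delta0_def PiE_iff)
qed

lemma two_cone_precomp:
  assumes "two_cone I A F L l" "f \<in> Mor A" "trg A f = L"
  shows "two_cone I A F (src A f) (nat_comp I A l (Delta1 I A f))"
proof -
  note l = two_coneD[OF assms(1)]
  interpret I: two_category I by (rule l)
  interpret A: two_category A by (rule l)
  note F = two_functorD[OF l(3)]
  have "F2 F \<kappa> \<star>\<^bsub>A\<^esub> idc A (ncmpt l (src I (dom2 I \<kappa>)) \<odot>\<^bsub>A\<^esub> f)
      = idc A (ncmpt l (trg I (dom2 I \<kappa>)) \<odot>\<^bsub>A\<^esub> f)" if "\<kappa> \<in> Cell I" for \<kappa>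
  proof -
    \<comment> \<open>The identity of the composite splits horizontally, so associativity peels off
      \<open>f\<close> and leaves the condition for the cone \<open>l\<close>.\<close>
    have "F2 F \<kappa> \<star>\<^bsub>A\<^esub> idc A (ncmpt l (src I (dom2 I \<kappa>)) \<odot>\<^bsub>A\<^esub> f)
        = F2 F \<kappa> \<star>\<^bsub>A\<^esub> (idc A (ncmpt l (src I (dom2 I \<kappa>))) \<star>\<^bsub>A\<^esub> idc A f)"
      using that assms by (simp add: l)
    also have "\<dots> = (F2 F \<kappa> \<star>\<^bsub>A\<^esub> idc A (ncmpt l (src I (dom2 I \<kappa>)))) \<star>\<^bsub>A\<^esub> idc A f"
      using that assms by (intro A.hcomp_assoc) (auto simp: l F)
    finally show ?thesis
      using that assms by (simp add: l)
  qed
  moreover have "F1 F k \<odot>\<^bsub>A\<^esub> (ncmpt l (src I k) \<odot>\<^bsub>A\<^esub> f) = ncmpt l (trg I k) \<odot>\<^bsub>A\<^esub> f"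
    if "k \<in> Mor I" for k
    using that assms A.comp1_assoc[of f "ncmpt l (src I k)" "F1 F k"] by (simp add: l F)
  ultimately show ?thesis
    unfolding two_cone_iff using assms l
    by (simp add: nat_comp_def Delta1_def)
qed

lemma cone_functor_simps:
  "onObj (cone_functor I A l) f = nat_comp I A l (Delta1 I A f)"
  "mdom (onArr (cone_functor I A l) \<alpha>) = nat_comp I A l (Delta1 I A (dom2 A \<alpha>))"
  "mcod (onArr (cone_functor I A l) \<alpha>) = nat_comp I A l (Delta1 I A (cod2 A \<alpha>))"
  "mdf (onArr (cone_functor I A l) \<alpha>) = (\<lambda>i\<in>Ob I. idc A (ncmpt l i) \<star>\<^bsub>A\<^esub> \<alpha>)"
  by (auto simp: cone_functor_def functor_comp_def postcomp_def Delta_hom_def functor_2cat_def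
      Delta2_def)

text \<open>Compatibility along \<open>k\<close> is the equation \<open>F k\<close> after
  \<open>l\<close> at the source of \<open>k\<close> equals \<open>l\<close> at its target,
  whiskered with \<alpha>.\<close>

lemma modification_whisker_cone:
  assumes "two_cone I A F L l" "\<alpha> \<in> Cell A" "trg A (dom2 A \<alpha>) = L"
  shows "modification I A (onArr (cone_functor I A l) \<alpha>)"
proof -
  note l = two_coneD[OF assms(1)]
  interpret I: two_category I by (rule l)
  interpret A: two_category A by (rule l)
  note F = two_functorD[OF l(3)]
  have c: "two_cone I A F (src A (dom2 A \<alpha>)) (mdom (onArr (cone_functor I A l) \<alpha>))"
    "two_cone I A F (src A (dom2 A \<alpha>)) (mcod (onArr (cone_functor I A l) \<alpha>))"
    unfolding cone_functor_simps
    using two_cone_precomp[OF assms(1), of "dom2 A \<alpha>"] two_cone_precomp[OF assms(1), of "cod2 A \<alpha>"]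
      assms(2,3) by auto
  have "idc A (F1 F k) \<star>\<^bsub>A\<^esub> (idc A (ncmpt l (src I k)) \<star>\<^bsub>A\<^esub> \<alpha>) = idc A (ncmpt l (trg I k)) \<star>\<^bsub>A\<^esub> \<alpha>"
    if "k \<in> Mor I" for k
    using that assms A.hcomp_assoc[of \<alpha> "idc A (ncmpt l (src I k))" "idc A (F1 F k)"]
    by (simp add: l F)
  then show ?thesis
    unfolding modification_cones_iff[OF c]
    using assms by (auto simp: cone_functor_simps nat_comp_def Delta1_def l)
qed

text \<open>Equality of modifications is reduced to boundaries and components; vertical composition
  is then preserved because left whiskering distributes over it.\<close>

lemma is_functor_cone_functor:
  assumes "two_cone I A F L l"
  shows "is_functor (hom_cat A X L) (hom_cat (functor_2cat I A) (Delta0 I A X) F) (cone_functor I A l)"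
proof -
  note l = two_coneD[OF assms]
  interpret I: two_category I by (rule l)
  interpret A: two_category A by (rule l)
  have eq: "\<phi> = \<psi>" if "mdom \<phi> = mdom \<psi>" "mcod \<phi> = mcod \<psi>" "mdf \<phi> = mdf \<psi>"
    for \<phi> \<psi> :: "('a, 'b, 'c, 'd, 'e, 'f) modif"
    using that by simp
  have "two_nat I A (nat_comp I A l (Delta1 I A f))" if "f \<in> Mor A" "trg A f = L" for f
    using two_cone_precomp[OF assms that] by (simp add: two_cone_def)
  moreover have "onArr (cone_functor I A l) (idc A f)
      = idc (functor_2cat I A) (onObj (cone_functor I A l) f)" if "f \<in> Mor A" "trg A f = L" for f
    using that
    by (intro eq)
      (auto simp: cone_functor_simps functor_2cat_def nat_comp_def Delta1_def l intro!: restrict_ext)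
  moreover have "onArr (cone_functor I A l) (\<beta> \<bullet>\<^bsub>A\<^esub> \<alpha>)
      = onArr (cone_functor I A l) \<beta> \<bullet>\<^bsub>functor_2cat I A\<^esub> onArr (cone_functor I A l) \<alpha>"
    if "\<alpha> \<in> Cell A" "\<beta> \<in> Cell A" "dom2 A \<beta> = cod2 A \<alpha>" "trg A (dom2 A \<alpha>) = L" for \<alpha> \<beta>
    using that
    by (intro eq)
      (auto simp: functor_2cat_simps cone_functor_simps l A.whisker_left_vcomp intro!: restrict_ext)
  ultimately show ?thesis
    using A.category_hom_cat[of X L] category_hom_functor_2cat[OF l(1,2), of "Delta0 I A X" F]
    unfolding is_functor_def
    by (auto simp: hom_cat_def functor_2cat_def cone_functor_simps modification_whisker_cone[OF assms]
       nat_comp_def Delta1_def l)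
qed

section \<open>The strict slice\<close>

lemma strict_slice_simps [simp]:
  "Ob (strict_slice I A F) = {(X, \<mu>). two_cone I A F X \<mu>}"
  "src (strict_slice I A F) (P, f, Q) = P"
  "trg (strict_slice I A F) (P, f, Q) = Q"
  "dom2 (strict_slice I A F) (P, \<alpha>, Q) = (P, dom2 A \<alpha>, Q)"
  "cod2 (strict_slice I A F) (P, \<alpha>, Q) = (P, cod2 A \<alpha>, Q)"
  "idm (strict_slice I A F) P = (P, idm A (fst P), P)"
  "comp1 (strict_slice I A F) (Q, g, R) (P, f, Q') = (P, g \<odot>\<^bsub>A\<^esub> f, R)"
  "idc (strict_slice I A F) (P, f, Q) = (P, idc A f, Q)"
  "vcomp (strict_slice I A F) (P', \<beta>, Q') (P, \<alpha>, Q) = (P, \<beta> \<bullet>\<^bsub>A\<^esub> \<alpha>, Q)"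
  "hcomp (strict_slice I A F) (Q, \<beta>, R) (P, \<alpha>, Q') = (P, \<beta> \<star>\<^bsub>A\<^esub> \<alpha>, R)"
  by (auto simp: strict_slice_def Let_def split: prod.splits)

text \<open>The boundary functors agree because both sides are cones over \<open>F\<close> with
  vertex \<open>X\<close>, and extensionality reduces the rest to components on
  \<open>Ob I\<close>.\<close>

lemma cone_precomp_eq_iff:
  assumes "two_cone I A F X \<mu>" "two_cone I A F Y \<nu>" "src A f = X"
  shows "\<nu> \<odot>\<^bsub>functor_2cat I A\<^esub> Delta1 I A f = \<mu> \<longleftrightarrow> (\<forall>i\<in>Ob I. ncmpt \<nu> i \<odot>\<^bsub>A\<^esub> f = ncmpt \<mu> i)"
proof
  assume R: "\<forall>i\<in>Ob I. ncmpt \<nu> i \<odot>\<^bsub>A\<^esub> f = ncmpt \<mu> i"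
  have "(\<lambda>i\<in>Ob I. ncmpt \<nu> i \<odot>\<^bsub>A\<^esub> f) = ncmpt \<mu>"
    using R two_coneD(12)[OF assms(1)] by (intro extensionalityI[where A = "Ob I"]) auto
  then show "\<nu> \<odot>\<^bsub>functor_2cat I A\<^esub> Delta1 I A f = \<mu>"
    using assms by (auto simp: functor_2cat_def nat_comp_def Delta1_def two_coneD(5,6) cong: restrict_cong)
qed (auto simp: functor_2cat_def nat_comp_def Delta1_def)

lemma strict_slice_Mor_iff:
  "(P, f, Q) \<in> Mor (strict_slice I A F) \<longleftrightarrow>
     two_cone I A F (fst P) (snd P) \<and> two_cone I A F (fst Q) (snd Q)
     \<and> f \<in> Mor A \<and> src A f = fst P \<and> trg A f = fst Q
     \<and> snd Q \<odot>\<^bsub>functor_2cat I A\<^esub> Delta1 I A f = snd P"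
  by (cases P; cases Q) (auto simp: strict_slice_def Let_def)

lemma strict_slice_Cell_iff:
  "(P, \<alpha>, Q) \<in> Cell (strict_slice I A F) \<longleftrightarrow>
     \<alpha> \<in> Cell A \<and> (P, dom2 A \<alpha>, Q) \<in> Mor (strict_slice I A F)
     \<and> (P, cod2 A \<alpha>, Q) \<in> Mor (strict_slice I A F)
     \<and> idc (functor_2cat I A) (snd Q) \<star>\<^bsub>functor_2cat I A\<^esub> Delta2 I A \<alpha> = idc (functor_2cat I A) (snd P)"
  unfolding strict_slice_Mor_iff
  by (cases P; cases Q; simp add: strict_slice_def Let_def; rule iffI; elim conjE; simp)

lemma strict_slice_Mor [simp]:
  "(P, f, Q) \<in> Mor (strict_slice I A F) \<longleftrightarrow>
     two_cone I A F (fst P) (snd P) \<and> two_cone I A F (fst Q) (snd Q)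
     \<and> f \<in> Mor A \<and> src A f = fst P \<and> trg A f = fst Q
     \<and> (\<forall>i\<in>Ob I. ncmpt (snd Q) i \<odot>\<^bsub>A\<^esub> f = ncmpt (snd P) i)"
  unfolding strict_slice_Mor_iff
  using cone_precomp_eq_iff[of I A F "fst P" "snd P" "fst Q" "snd Q" f] by argo

text \<open>Once both boundaries of \<alpha> are slice morphisms, the two modifications compared in
  the definition have the same domain and codomain, so only their components remain.\<close>

lemma strict_slice_Cell [simp]:
  "(P, \<alpha>, Q) \<in> Cell (strict_slice I A F) \<longleftrightarrow>
     \<alpha> \<in> Cell A \<and> (P, dom2 A \<alpha>, Q) \<in> Mor (strict_slice I A F)
     \<and> (P, cod2 A \<alpha>, Q) \<in> Mor (strict_slice I A F)
     \<and> (\<forall>i\<in>Ob I. idc A (ncmpt (snd Q) i) \<star>\<^bsub>A\<^esub> \<alpha> = idc A (ncmpt (snd P) i))"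
proof -
  define FC where "FC = functor_2cat I A"
  have "idc FC \<nu> \<star>\<^bsub>FC\<^esub> Delta2 I A \<alpha> = idc FC \<mu>
      \<longleftrightarrow> (\<forall>i\<in>Ob I. idc A (ncmpt \<nu> i) \<star>\<^bsub>A\<^esub> \<alpha> = idc A (ncmpt \<mu> i))"
    if "\<nu> \<odot>\<^bsub>FC\<^esub> Delta1 I A (dom2 A \<alpha>) = \<mu>" "\<nu> \<odot>\<^bsub>FC\<^esub> Delta1 I A (cod2 A \<alpha>) = \<mu>" for \<mu> \<nu>
  proof -
    have "idc FC \<nu> \<star>\<^bsub>FC\<^esub> Delta2 I A \<alpha>
        = \<lparr>mdom = \<mu>, mcod = \<mu>, mdf = (\<lambda>i\<in>Ob I. idc A (ncmpt \<nu> i) \<star>\<^bsub>A\<^esub> \<alpha>)\<rparr>"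
      using that by (auto simp: FC_def functor_2cat_def Delta2_def intro!: restrict_ext)
    moreover have "idc FC \<mu> = \<lparr>mdom = \<mu>, mcod = \<mu>, mdf = (\<lambda>i\<in>Ob I. idc A (ncmpt \<mu> i))\<rparr>"
      by (simp add: FC_def functor_2cat_def)
    ultimately show ?thesis
      by (auto simp: fun_eq_iff restrict_def)
  qed
  then show ?thesis
    unfolding strict_slice_Cell_iff FC_def[symmetric]
    unfolding strict_slice_Mor_iff FC_def[symmetric] by blast
qed

text \<open>The laws are inherited from \<open>A\<close>. Closure under composition uses
  associativity for the cone equations, and distributivity of whiskering for vertical
  composites.\<close>

lemma two_category_strict_slice:
  assumes "two_category I" "two_category A"
  shows "two_category (strict_slice I A F)"
proof -
  interpret A: two_category A by fact
  note [simp] = two_coneD(4,7-9)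
  show ?thesis
  proof (rule two_category.intro)
    show "category (cat1 (strict_slice I A F))"
      by unfold_locales (auto simp: cat1_def A.comp1_assoc)
    show "category (vcat (strict_slice I A F))"
      by unfold_locales (auto simp: vcat_def A.whisker_left_vcomp A.vcomp_assoc)
    show "category (hcat (strict_slice I A F))"
      by unfold_locales (auto simp: hcat_def A.comp1_assoc A.hcomp_assoc)
  qed (auto simp: A.interchange)
qed

section \<open>The example\<close>

text \<open>An identity on the left of a composite is absorbed; otherwise reassociation moves the
  leftmost generator to the front.\<close>

lemma mwf_decompose:
  assumes "mwf P t"
  shows "(\<exists>x. meq P t (MId x)) \<or> (\<exists>g u. meq P t (MComp (MGen g) u))"
  using assms
proof (induction rule: mwf.induct)
  case (mwf_Id x)
  then show ?case by (blast intro: meq.meq_refl mwf.mwf_Id)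
next
  case (mwf_Gen g)
  then have "mwf P (MGen g)" by (intro mwf.mwf_Gen)
  then show ?case by (blast intro: meq.meq_sym meq.meq_Id_right)
next
  case (mwf_Comp u t)
  from mwf_Comp.IH(1) show ?case
  proof (elim disjE exE)
    fix x assume u: "meq P u (MId x)"
    then have "mtrg P t = x"
      using mwf_Comp.hyps meq_parallel[OF u] by simp
    then have "meq P (MComp u t) t"
      using mwf_Comp.hyps meq_MComp[OF u meq.meq_refl, of t] meq.meq_Id_left[of P t]
      by (auto intro: meq.meq_trans)
    then show ?thesis using mwf_Comp.IH(2) by (blast intro: meq.meq_trans)
  next
    fix g v assume u: "meq P u (MComp (MGen g) v)"
    then have "meq P (MComp u t) (MComp (MComp (MGen g) v) t)"
      using mwf_Comp.hyps by (intro meq_MComp meq.meq_refl)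
    moreover have "meq P (MComp (MComp (MGen g) v) t) (MComp (MGen g) (MComp v t))"
      using meq_parallel[OF u] mwf_Comp.hyps by (intro meq.meq_sym[OF meq.meq_assoc]) auto
    ultimately show ?thesis by (blast intro: meq.meq_trans)
  qed
qed

lemma generated_Mor_cases:
  assumes "h \<in> Mor (generated_2cat P)"
  obtains (Id) x where "x \<in> gobs P" "h = mcls P (MId x)"
  | (Gen) g k where "mwf P (MGen g)" "k \<in> Mor (generated_2cat P)" "trg (generated_2cat P) k = gsrc P g"
      "h = mcls P (MGen g) \<odot>\<^bsub>generated_2cat P\<^esub> k"
proof -
  obtain t where t: "mwf P t" "h = mcls P t"
    using assms by (rule Mor_generatedE)
  from mwf_decompose[OF t(1)] show thesis
  proof (elim disjE exE)
    fix x assume x: "meq P t (MId x)"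
    show thesis
      using Id[of x] t meq_parallel[OF x] mcls_eqI[OF x] by simp
  next
    fix g u assume u: "meq P t (MComp (MGen g) u)"
    then show thesis
      using Gen[of g "mcls P u"] t meq_parallel[OF u] mcls_eqI[OF u] by simp
  qed
qed

interpretation exA: two_category exA
  unfolding exA_def by (rule two_category_generated)

lemma mwf_ex_gen [simp]: "mwf ex_pres (MGen m)"
  by (rule mwf.mwf_Gen) (simp_all add: ex_pres_def)

lemma ex_gobs [simp]: "x \<in> gobs ex_pres"
  by (simp add: ex_pres_def)

lemma ex_gen_endpoints [simp]:
  "gsrc ex_pres gen_f = obX" "gtrg ex_pres gen_f = obL"
  "gsrc ex_pres gen_g = obX" "gtrg ex_pres gen_g = obL"
  "gsrc ex_pres gen_l0 = obL" "gtrg ex_pres gen_l0 = obB"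
  "gsrc ex_pres gen_l1 = obL" "gtrg ex_pres gen_l1 = obC"
  "gsrc ex_pres gen_b = obB" "gtrg ex_pres gen_b = obA"
  "gsrc ex_pres gen_c = obC" "gtrg ex_pres gen_c = obA"
  by (simp_all add: ex_pres_def)

lemma exA_Ob [simp]: "x \<in> Ob exA"
  by (simp add: exA_def)

lemma exMor_simps [simp]:
  "exMor m \<in> Mor exA" "src exA (exMor m) = gsrc ex_pres m" "trg exA (exMor m) = gtrg ex_pres m"
  by (simp_all add: exA_def)

lemma exMor_square: "exMor gen_b \<odot>\<^bsub>exA\<^esub> exMor gen_l0 = exMor gen_c \<odot>\<^bsub>exA\<^esub> exMor gen_l1"
  \<comment> \<open>Only the field \<open>mrels\<close> is unfolded; \<open>ex_pres\<close> itself
    stays folded, so that the rules about it still apply.\<close>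
  by (auto simp: exA_def ex_pres_def[THEN arg_cong[where f = mrels]]
      intro!: mcls_eqI meq.meq_rel del: equalityI)

lemma exMor_cases:
  assumes "h \<in> Mor exA"
  obtains (Id) "h = idm exA (trg exA h)" "src exA h = trg exA h"
  | (Gen) g k where "k \<in> Mor exA" "trg exA k = gsrc ex_pres g" "trg exA h = gtrg ex_pres g"
      "src exA h = src exA k" "h = exMor g \<odot>\<^bsub>exA\<^esub> k"
proof -
  from assms have "h \<in> Mor (generated_2cat ex_pres)" by (simp add: exA_def)
  then show thesis
  proof (cases rule: generated_Mor_cases)
    case (Id x)
    then have "h = idm exA x" by (simp add: exA_def)
    then show ?thesis using that(1) by simp
  next
    case (Gen g k)
    then show ?thesis using that(2)[of k g] by (simp flip: exA_def)
  qed
qed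

text \<open>No generator ends in \<open>obX\<close>, so only the identity alternative of
  \<open>exMor_cases\<close> survives.\<close>

lemma into_X:
  assumes "h \<in> Mor exA" "trg exA h = obX"
  shows "src exA h = obX" "h = idm exA obX"
proof -
  have "gtrg ex_pres g \<noteq> obX" for g by (cases g) auto
  with assms show "src exA h = obX" "h = idm exA obX"
    by (cases rule: exMor_cases; auto)+
qed

text \<open>The last generator can only be \<open>gen_f\<close> or \<open>gen_g\<close>, and what
  precedes it ends in \<open>obX\<close>, hence is an identity.\<close>

lemma into_L:
  assumes "h \<in> Mor exA" "trg exA h = obL"
  shows "h = idm exA obL \<or> h = exMor gen_f \<or> h = exMor gen_g"
  using assms(1)
proof (cases rule: exMor_cases)
  case (Gen g k)
  with assms have "g = gen_f \<or> g = gen_g" by (cases g) auto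
  with Gen into_X[of k] show ?thesis by auto
qed (use assms in auto)

text \<open>The only generator ending in \<open>obB\<close> is \<open>gen_l0\<close>. For the
  identity only the source is recorded; that is enough to exclude it as a component of a
  cone.\<close>

lemma into_B:
  assumes "h \<in> Mor exA" "trg exA h = obB"
  shows "src exA h = obB \<or>
    (\<exists>k\<in>Mor exA. trg exA k = obL \<and> src exA k = src exA h \<and> h = exMor gen_l0 \<odot>\<^bsub>exA\<^esub> k)"
  using assms(1)
proof (cases rule: exMor_cases)
  case (Gen g k)
  with assms have "g = gen_l0" by (cases g) auto
  with Gen show ?thesis by auto
qed (use assms in auto)

lemma into_C:
  assumes "h \<in> Mor exA" "trg exA h = obC"
  shows "src exA h = obC \<or>
    (\<exists>k\<in>Mor exA. trg exA k = obL \<and> src exA k = src exA h \<and> h = exMor gen_l1 \<odot>\<^bsub>exA\<^esub> k)"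
  using assms(1)
proof (cases rule: exMor_cases)
  case (Gen g k)
  with assms have "g = gen_l1" by (cases g) auto
  with Gen show ?thesis by auto
qed (use assms in auto)

section \<open>An invariant separating the morphisms into \<open>obL\<close>\<close>

text \<open>Only \<open>gen_f\<close> and \<open>gen_g\<close> are counted; the other four
  generators are those exchanged by the relation on morphisms.\<close>

primrec occ :: "('o, gen_mor) mtm \<Rightarrow> gen_mor set" where
  "occ (MId x) = {}"
| "occ (MGen m) = {m} \<inter> {gen_f, gen_g}"
| "occ (MComp u t) = occ u \<union> occ t"

definition mocc :: "('o, gen_mor) mtm set \<Rightarrow> gen_mor set" where
  "mocc M = occ (rep M)"

lemma meq_occ: "meq ex_pres s t \<Longrightarrow> occ s = occ t"
  by (induction rule: meq.induct) (auto simp: ex_pres_def)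

lemma mocc_mcls: "mwf ex_pres t \<Longrightarrow> mocc (mcls ex_pres t) = occ t"
  using meq_occ[OF meq_rep_mcls, of t] by (simp add: mocc_def)

lemma mocc_simps [simp]:
  "mocc (exMor m) = {m} \<inter> {gen_f, gen_g}"
  "mocc (idm exA x) = {}"
  by (simp_all add: mocc_mcls exA_def)

lemma mocc_comp1 [simp]:
  "h \<in> Mor exA \<Longrightarrow> k \<in> Mor exA \<Longrightarrow> src exA h = trg exA k
    \<Longrightarrow> mocc (h \<odot>\<^bsub>exA\<^esub> k) = mocc h \<union> mocc k"
  unfolding exA_def by (auto elim!: Mor_generatedE simp: mocc_mcls)

text \<open>The three candidates from \<open>into_L\<close> have the distinct invariants
  \<open>{}\<close>, \<open>{gen_f}\<close> and \<open>{gen_g}\<close>.\<close>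

lemma into_L_eqI:
  assumes "h \<in> Mor exA" "k \<in> Mor exA" "trg exA h = obL" "trg exA k = obL" "mocc h = mocc k"
  shows "h = k"
  using into_L[of h] into_L[of k] assms by auto

section \<open>2-morphisms into \<open>obL\<close> are identities\<close>

lemma mtrg_XL_imp_msrc_XL:
  "mwf ex_pres t \<Longrightarrow> mtrg ex_pres t \<in> {obX, obL} \<Longrightarrow> msrc ex_pres t \<in> {obX, obL}"
proof (induction rule: mwf.induct)
  case (mwf_Gen g)
  then show ?case by (cases g) auto
qed auto

text \<open>Generating 2-morphisms end in \<open>obB\<close> or \<open>obC\<close>. The claim
  includes \<open>obX\<close> for the sake of horizontal composites: the right factor ends where the
  left one starts, which by \<open>mtrg_XL_imp_msrc_XL\<close> is again \<open>obX\<close> or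
  \<open>obL\<close>.\<close>

lemma ceq_CId_if_trg_XL:
  "cwf ex_pres c \<Longrightarrow> mtrg ex_pres (cdom ex_pres c) \<in> {obX, obL} \<Longrightarrow> \<exists>t. ceq ex_pres c (CId t)"
proof (induction rule: cwf.induct)
  case (cwf_Gen h)
  then show ?case by (cases h) (auto simp: ex_pres_def)
next
  case (cwf_Id t)
  then show ?case by (auto intro!: exI ceq.ceq_refl)
next
  case (cwf_V d c)
  have "mtrg ex_pres (cdom ex_pres d) = mtrg ex_pres (cdom ex_pres c)"
    using cwf_V.hyps cwf_boundary[of ex_pres c] by (auto dest: meq_parallel)
  then obtain s where s: "ceq ex_pres d (CId s)" using cwf_V by auto
  \<comment> \<open>The identity \<open>d\<close> is rewritten to the exact form required by the
    left unit rule, so that the composite reduces to \<open>c\<close>.\<close>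
  have "ceq ex_pres (CV d c) (CV (CId (ccod ex_pres c)) c)"
  proof (rule ceq.ceq_V)
    have "meq ex_pres s (ccod ex_pres c)"
      using ceq_boundary[OF s] cwf_V.hyps by (auto intro: meq.meq_trans meq.meq_sym)
    then show "ceq ex_pres d (CId (ccod ex_pres c))"
      using s by (blast intro: ceq.ceq_trans ceq.ceq_Id)
  qed (use cwf_V.hyps in \<open>auto intro: ceq.ceq_refl\<close>)
  then have "ceq ex_pres (CV d c) c"
    using cwf_V.hyps by (blast intro: ceq.ceq_trans ceq.ceq_V_Id_left)
  then show ?case using cwf_V by (auto intro: ceq.ceq_trans)
next
  case (cwf_H d c)
  have "mtrg ex_pres (cdom ex_pres c) \<in> {obX, obL}"
    using cwf_H.hyps cwf_H.prems cwf_boundary[of ex_pres d] mtrg_XL_imp_msrc_XL[of "cdom ex_pres d"]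
    by simp
  then obtain s t where st: "ceq ex_pres d (CId s)" "ceq ex_pres c (CId t)"
    using cwf_H by auto
  then have "msrc ex_pres s = mtrg ex_pres t" "mwf ex_pres s" "mwf ex_pres t"
    using cwf_H.hyps by (auto dest!: ceq_boundary meq_parallel)
  then have "ceq ex_pres (CH (CId s) (CId t)) (CId (MComp s t))"
    by (intro ceq.ceq_H_Id) auto
  moreover have "ceq ex_pres (CH d c) (CH (CId s) (CId t))"
    using st cwf_H.hyps by (intro ceq.ceq_H) auto
  ultimately show ?case by (blast intro: ceq.ceq_trans)
qed

lemma cell_into_L:
  assumes "\<alpha> \<in> Cell exA" "trg exA (dom2 exA \<alpha>) = obL"
  shows "\<alpha> = idc exA (dom2 exA \<alpha>)"
proof -
  obtain c where c: "cwf ex_pres c" "\<alpha> = ccls ex_pres c"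
    using assms(1) unfolding exA_def by (rule Cell_generatedE)
  then have "mtrg ex_pres (cdom ex_pres c) = obL"
    using assms(2) cwf_boundary[of ex_pres c] by (simp add: exA_def)
  then obtain t where t: "ceq ex_pres c (CId t)"
    using ceq_CId_if_trg_XL[OF c(1)] by auto
  then have "mwf ex_pres t" using ceq_boundary by fastforce
  then show ?thesis
    using ccls_eqI[OF t] c by (simp add: exA_def)
qed

section \<open>The cospan diagram and its cones\<close>

text \<open>A case split on arrows suffices: the composability hypotheses discard the pairs on which
  \<open>cospan_comp\<close> is \<open>undefined\<close>.\<close>

lemma category_pullback_shape: "category pullback_shape"
proof
  fix f g h
  assume "Dom pullback_shape g = Cod pullback_shape f" "Dom pullback_shape h = Cod pullback_shape g"
  then show "Cmp pullback_shape h (Cmp pullback_shape g f) = Cmp pullback_shape (Cmp pullback_shape h g) f"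
    by (cases f; cases g; cases h) (auto simp: pullback_shape_def)
next
  fix f g
  assume "Dom pullback_shape g = Cod pullback_shape f"
  then show "Dom pullback_shape (Cmp pullback_shape g f) = Dom pullback_shape f"
    "Cod pullback_shape (Cmp pullback_shape g f) = Cod pullback_shape g"
    by (cases f; cases g; auto simp: pullback_shape_def)+
next
  fix f
  show "Cmp pullback_shape f (Ide pullback_shape (Dom pullback_shape f)) = f"
    by (cases f) (auto simp: pullback_shape_def)
qed (auto simp: pullback_shape_def)

interpretation shape: two_category shape
  by (rule two_category_locally_discrete[OF category_pullback_shape])

lemma shape_simps [simp]:
  "Ob shape = UNIV" "Mor shape = UNIV" "Cell shape = UNIV"
  "src shape = cospan_dom" "trg shape = cospan_cod" "dom2 shape = (\<lambda>f. f)" "cod2 shape = (\<lambda>f. f)"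
  "idm shape = CospanId" "comp1 shape = cospan_comp" "idc shape = (\<lambda>f. f)"
  "vcomp shape = (\<lambda>_ f. f)" "hcomp shape = cospan_comp"
  by (auto simp: locally_discrete_def pullback_shape_def)

lemma exF_simps [simp]: "F0 exF = exF0" "F1 exF = exF1" "F2 exF = (\<lambda>f. idc exA (exF1 f))"
  by (auto simp: exF_def)

lemma exF1_in [simp]:
  "exF1 k \<in> Mor exA" "src exA (exF1 k) = exF0 (cospan_dom k)" "trg exA (exF1 k) = exF0 (cospan_cod k)"
  by (cases k; simp)+

lemma two_functor_exF: "two_functor shape exA exF"
proof -
  have "exF1 (cospan_comp g f) = exF1 g \<odot>\<^bsub>exA\<^esub> exF1 f" if "cospan_dom g = cospan_cod f" for f g
    using that by (cases g; cases f) auto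
  then show ?thesis
    using exA.two_category_axioms shape.two_category_axioms by (auto simp: two_functor_def)
qed

text \<open>Identity arrows and the identity 2-morphisms impose nothing new, so the two legs carry
  all naturality conditions.\<close>

lemma two_cone_exF_iff:
  "two_cone shape exA exF Y \<mu> \<longleftrightarrow> ndom \<mu> = Delta0 shape exA Y \<and> ncod \<mu> = exF
     \<and> (\<forall>i. ncmpt \<mu> i \<in> Mor exA \<and> src exA (ncmpt \<mu> i) = Y \<and> trg exA (ncmpt \<mu> i) = exF0 i)
     \<and> exMor gen_b \<odot>\<^bsub>exA\<^esub> ncmpt \<mu> FootL = ncmpt \<mu> Apex
     \<and> exMor gen_c \<odot>\<^bsub>exA\<^esub> ncmpt \<mu> FootR = ncmpt \<mu> Apex"
proof -
  have legs: "(\<forall>k. exF1 k \<odot>\<^bsub>exA\<^esub> m (cospan_dom k) = m (cospan_cod k))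
      \<longleftrightarrow> exMor gen_b \<odot>\<^bsub>exA\<^esub> m FootL = m Apex \<and> exMor gen_c \<odot>\<^bsub>exA\<^esub> m FootR = m Apex"
    if "\<forall>i. m i \<in> Mor exA \<and> trg exA (m i) = exF0 i" for m
  proof (intro iffI allI)
    fix k
    assume "exMor gen_b \<odot>\<^bsub>exA\<^esub> m FootL = m Apex \<and> exMor gen_c \<odot>\<^bsub>exA\<^esub> m FootR = m Apex"
    then show "exF1 k \<odot>\<^bsub>exA\<^esub> m (cospan_dom k) = m (cospan_cod k)"
      using that by (cases k) auto
  qed (auto dest: spec[of _ LegL] spec[of _ LegR])
  show ?thesis
    unfolding two_cone_iff using two_functor_exF legs[of "ncmpt \<mu>"] by auto
qed

lemma exCone_simps [simp]:
  "ndom exCone = Delta0 shape exA obL" "ncod exCone = exF" "ncmpt exCone = exlam"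
  by (simp_all add: exCone_def)

lemma exlam_in [simp]: "exlam i \<in> Mor exA" "src exA (exlam i) = obL" "trg exA (exlam i) = exF0 i"
  by (cases i; simp)+

lemma two_cone_exCone: "two_cone shape exA exF obL exCone"
  unfolding two_cone_exF_iff by (simp add: exMor_square)

lemma all_cospan_ob: "(\<forall>i. Q i) \<longleftrightarrow> Q FootL \<and> Q Apex \<and> Q FootR"
  by (metis cospan_ob.exhaust)

section \<open>Unique factorization of cones and 2-terminality\<close>

text \<open>The components at the two feet factor through \<open>gen_l0\<close> and
  \<open>gen_l1\<close>. Commutativity over \<open>obA\<close> gives both factors the same
  invariant, hence makes them equal; the component at \<open>FootL\<close> alone determines the
  factor.\<close>

lemma cone_factors_uniquely:
  assumes "two_cone shape exA exF Y \<mu>"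
  shows "\<exists>!h. h \<in> Mor exA \<and> src exA h = Y \<and> trg exA h = obL
    \<and> (\<forall>i. exlam i \<odot>\<^bsub>exA\<^esub> h = ncmpt \<mu> i)"
proof -
  note \<mu> = assms[unfolded two_cone_exF_iff]
  have sq: "exMor gen_b \<odot>\<^bsub>exA\<^esub> ncmpt \<mu> FootL = exMor gen_c \<odot>\<^bsub>exA\<^esub> ncmpt \<mu> FootR"
    using \<mu> by simp
  have mB: "ncmpt \<mu> FootL \<in> Mor exA" "src exA (ncmpt \<mu> FootL) = Y" "trg exA (ncmpt \<mu> FootL) = obB"
    and mC: "ncmpt \<mu> FootR \<in> Mor exA" "src exA (ncmpt \<mu> FootR) = Y" "trg exA (ncmpt \<mu> FootR) = obC"
    using \<mu> by auto
  have L: "src exA k \<in> {obX, obL}" if "k \<in> Mor exA" "trg exA k = obL" for k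
    using into_L[OF that] by auto
  \<comment> \<open>A morphism into \<open>obC\<close> starts in \<open>obC\<close>,
    \<open>obL\<close> or \<open>obX\<close>, so the other foot of the cone excludes the identity
    alternative; symmetrically for \<open>obC\<close>.\<close>
  have "Y \<noteq> obB" using into_C[OF mC(1,3)] mC(2) L by force
  moreover have "Y \<noteq> obC" using into_B[OF mB(1,3)] mB(2) L by force
  ultimately obtain k l where k: "k \<in> Mor exA" "trg exA k = obL" "src exA k = Y"
      "ncmpt \<mu> FootL = exMor gen_l0 \<odot>\<^bsub>exA\<^esub> k"
    and l: "l \<in> Mor exA" "trg exA l = obL" "src exA l = Y"
      "ncmpt \<mu> FootR = exMor gen_l1 \<odot>\<^bsub>exA\<^esub> l"
    using into_B[OF mB(1,3)] into_C[OF mC(1,3)] unfolding mB(2) mC(2) by metis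
  have "mocc k = mocc l"
    using arg_cong[OF sq, of mocc] k l by simp
  then have "k = l" using k l by (intro into_L_eqI)
  show ?thesis
  proof (intro ex1I[of _ k] conjI)
    show "\<forall>i. exlam i \<odot>\<^bsub>exA\<^esub> k = ncmpt \<mu> i"
      \<comment> \<open>At the apex, reassociation turns the composite of \<open>gen_b\<close>,
        \<open>gen_l0\<close> and \<open>k\<close> into \<open>gen_b\<close> after the component at
        \<open>FootL\<close>.\<close>
      unfolding all_cospan_ob using k l \<open>k = l\<close> \<mu> by (auto simp flip: exA.comp1_assoc)
  next
    fix h
    assume h: "h \<in> Mor exA \<and> src exA h = Y \<and> trg exA h = obL
      \<and> (\<forall>i. exlam i \<odot>\<^bsub>exA\<^esub> h = ncmpt \<mu> i)"
    then have "exMor gen_l0 \<odot>\<^bsub>exA\<^esub> h = exMor gen_l0 \<odot>\<^bsub>exA\<^esub> k"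
      using k by (metis exlam.simps(1))
    from arg_cong[OF this, of mocc] h k show "h = k"
      by (intro into_L_eqI) auto
  qed (use k in auto)
qed

lemma two_terminal_exCone: "two_terminal (strict_slice shape exA exF) (obL, exCone)"
proof -
  let ?S = "strict_slice shape exA exF"
  have S: "two_category ?S"
    by (rule two_category_strict_slice[OF shape.two_category_axioms exA.two_category_axioms])
  have "isomorphic_cats (hom_cat ?S (Y, \<mu>) (obL, exCone)) terminal_cat"
    if \<mu>: "two_cone shape exA exF Y \<mu>" for Y \<mu>
  proof -
    obtain h where h: "h \<in> Mor exA" "src exA h = Y" "trg exA h = obL"
        "\<And>i. exlam i \<odot>\<^bsub>exA\<^esub> h = ncmpt \<mu> i"
      and uniq: "\<And>k. k \<in> Mor exA \<Longrightarrow> src exA k = Y \<Longrightarrow> trg exA k = obL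
        \<Longrightarrow> (\<forall>i. exlam i \<odot>\<^bsub>exA\<^esub> k = ncmpt \<mu> i) \<Longrightarrow> k = h"
      using ex1_implies_ex[OF cone_factors_uniquely[OF \<mu>]] ex1E[OF cone_factors_uniquely[OF \<mu>]]
      by metis
    have M: "((Y, \<mu>), k, obL, exCone) \<in> Mor ?S \<longleftrightarrow> k = h" for k
    proof
      assume "((Y, \<mu>), k, obL, exCone) \<in> Mor ?S"
      then show "k = h" by (intro uniq) simp_all
    qed (use h \<mu> two_cone_exCone in simp)
    \<comment> \<open>A 2-morphism of the slice ends in \<open>obL\<close>, so it is the identity of
      its domain \<open>h\<close>; conversely, whiskering that identity by the cone gives the
      identities of the components of \<mu>.\<close>
    have C: "((Y, \<mu>), \<alpha>, obL, exCone) \<in> Cell ?S \<longleftrightarrow> \<alpha> = idc exA h" for \<alpha>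
    proof
      assume a: "((Y, \<mu>), \<alpha>, obL, exCone) \<in> Cell ?S"
      then have "dom2 exA \<alpha> = h" "\<alpha> \<in> Cell exA"
        unfolding strict_slice_Cell M by auto
      then show "\<alpha> = idc exA h"
        using cell_into_L[of \<alpha>] h by simp
    next
      assume "\<alpha> = idc exA h"
      then show "((Y, \<mu>), \<alpha>, obL, exCone) \<in> Cell ?S"
        unfolding strict_slice_Cell M using h by simp
    qed
    have "Obj (hom_cat ?S (Y, \<mu>) (obL, exCone)) = {((Y, \<mu>), h, obL, exCone)}"
      by (auto simp: hom_cat_def M simp del: strict_slice_Mor)
    moreover have "Arr (hom_cat ?S (Y, \<mu>) (obL, exCone)) = {((Y, \<mu>), idc exA h, obL, exCone)}"
      by (auto simp: hom_cat_def C simp del: strict_slice_Cell)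
    ultimately show ?thesis
      by (intro isomorphic_cats_terminal two_category.category_hom_cat[OF S])
  qed
  then show ?thesis
    unfolding two_terminal_def using S two_cone_exCone by auto
qed

section \<open>A modification outside the image\<close>

definition exGam :: "gen_cell \<Rightarrow> (gen_ob, gen_mor, gen_cell) ctm set" where
  "exGam h = ccls ex_pres (CGen h)"

lemma cwf_ex_gen [simp]: "cwf ex_pres (CGen h)"
proof (rule cwf.cwf_Gen)
  show "mwf ex_pres (gdom ex_pres h)" "mwf ex_pres (gcod ex_pres h)"
    "msrc ex_pres (gdom ex_pres h) = msrc ex_pres (gcod ex_pres h)"
    "mtrg ex_pres (gdom ex_pres h) = mtrg ex_pres (gcod ex_pres h)"
    by (cases h; simp add: ex_pres_def[THEN arg_cong[where f = gdom]]
        ex_pres_def[THEN arg_cong[where f = gcod]])+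
qed (simp add: ex_pres_def)

lemma ex_gdom_gcod [simp]:
  "gdom ex_pres gam0 = MComp (MGen gen_l0) (MGen gen_f)"
  "gcod ex_pres gam0 = MComp (MGen gen_l0) (MGen gen_g)"
  "gdom ex_pres gam1 = MComp (MGen gen_l1) (MGen gen_f)"
  "gcod ex_pres gam1 = MComp (MGen gen_l1) (MGen gen_g)"
  by (simp_all add: ex_pres_def)

lemma exGam_simps [simp]:
  "exGam h \<in> Cell exA"
  "dom2 exA (exGam gam0) = exMor gen_l0 \<odot>\<^bsub>exA\<^esub> exMor gen_f"
  "cod2 exA (exGam gam0) = exMor gen_l0 \<odot>\<^bsub>exA\<^esub> exMor gen_g"
  "dom2 exA (exGam gam1) = exMor gen_l1 \<odot>\<^bsub>exA\<^esub> exMor gen_f"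
  "cod2 exA (exGam gam1) = exMor gen_l1 \<odot>\<^bsub>exA\<^esub> exMor gen_g"
  by (simp_all add: exGam_def exA_def)

text \<open>\<open>ceq_rel\<close> applies only once the boundaries of both sides agree in the
  quotient; this follows by reassociating and using the commuting square.\<close>

lemma exGam_relation:
  "idc exA (exMor gen_b) \<star>\<^bsub>exA\<^esub> exGam gam0 = idc exA (exMor gen_c) \<star>\<^bsub>exA\<^esub> exGam gam1"
proof -
  have rel: "(CH (CId (MGen gen_b)) (CGen gam0), CH (CId (MGen gen_c)) (CGen gam1)) \<in> crels ex_pres"
    by (simp add: ex_pres_def)
  have sq: "meq ex_pres (MComp (MGen gen_b) (MGen gen_l0)) (MComp (MGen gen_c) (MGen gen_l1))"
    using exMor_square by (simp add: exA_def mcls_eqD)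
  have "meq ex_pres (MComp (MGen gen_b) (MComp (MGen gen_l0) (MGen m)))
      (MComp (MGen gen_c) (MComp (MGen gen_l1) (MGen m)))" if "m \<in> {gen_f, gen_g}" for m
  proof -
    have "meq ex_pres (MComp (MGen gen_b) (MComp (MGen gen_l0) (MGen m)))
        (MComp (MComp (MGen gen_b) (MGen gen_l0)) (MGen m))"
      using that by (intro meq.meq_assoc) auto
    moreover have "meq ex_pres (MComp (MComp (MGen gen_b) (MGen gen_l0)) (MGen m))
        (MComp (MComp (MGen gen_c) (MGen gen_l1)) (MGen m))"
      using that by (intro meq_MComp sq meq.meq_refl) auto
    moreover have "meq ex_pres (MComp (MComp (MGen gen_c) (MGen gen_l1)) (MGen m))
        (MComp (MGen gen_c) (MComp (MGen gen_l1) (MGen m)))"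
      using that by (intro meq.meq_sym[OF meq.meq_assoc]) auto
    ultimately show ?thesis by (blast intro: meq.meq_trans)
  qed
  then have "ceq ex_pres (CH (CId (MGen gen_b)) (CGen gam0)) (CH (CId (MGen gen_c)) (CGen gam1))"
    by (intro ceq.ceq_rel[OF rel]) simp_all
  then show ?thesis
    by (simp add: exGam_def exA_def ccls_eqI)
qed

text \<open>At the apex either whiskered generator may be taken: their equality in
  \<open>exGam_relation\<close> is exactly the compatibility along \<open>LegR\<close>.\<close>

primrec exmod :: "cospan_ob \<Rightarrow> (gen_ob, gen_mor, gen_cell) ctm set" where
  "exmod FootL = exGam gam0"
| "exmod Apex = idc exA (exMor gen_b) \<star>\<^bsub>exA\<^esub> exGam gam0"
| "exmod FootR = exGam gam1"

lemma not_surjective_cone_functor: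
  "\<not> surjective_on_arrows (hom_cat exA obX obL)
     (hom_cat (functor_2cat shape exA) (Delta0 shape exA obX) exF) (cone_functor shape exA exCone)"
proof
  assume surj: "surjective_on_arrows (hom_cat exA obX obL)
     (hom_cat (functor_2cat shape exA) (Delta0 shape exA obX) exF) (cone_functor shape exA exCone)"
  define cone where "cone m = nat_comp shape exA exCone (Delta1 shape exA (exMor m))" for m
  define \<phi> where "\<phi> = \<lparr>mdom = cone gen_f, mcod = cone gen_g, mdf = exmod\<rparr>"
  have cone: "two_cone shape exA exF obX (cone gen_f)" "two_cone shape exA exF obX (cone gen_g)"
    unfolding cone_def using two_cone_precomp[OF two_cone_exCone, of "exMor gen_f"]
      two_cone_precomp[OF two_cone_exCone, of "exMor gen_g"] by auto
  have ncmpt_cone: "ncmpt (cone m) i = exlam i \<odot>\<^bsub>exA\<^esub> exMor m" for m i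
    by (simp add: cone_def nat_comp_def Delta1_def)
  have "modification shape exA \<phi>"
  proof (subst modification_cones_iff)
    have "idc exA (exF1 k) \<star>\<^bsub>exA\<^esub> exmod (cospan_dom k) = exmod (cospan_cod k)" for k
    proof (cases k)
      case (CospanId i)
      then show ?thesis by (cases i) auto
    qed (auto simp: exGam_relation)
    moreover have "exmod i \<in> Cell exA \<and> dom2 exA (exmod i) = exlam i \<odot>\<^bsub>exA\<^esub> exMor gen_f
        \<and> cod2 exA (exmod i) = exlam i \<odot>\<^bsub>exA\<^esub> exMor gen_g" for i
      by (cases i) (auto simp: exA.comp1_assoc)
    ultimately show "mdf \<phi> \<in> Ob shape \<rightarrow>\<^sub>E Cell exA
      \<and> (\<forall>i\<in>Ob shape. dom2 exA (mdf \<phi> i) = ncmpt (mdom \<phi>) i \<and> cod2 exA (mdf \<phi> i) = ncmpt (mcod \<phi>) i)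
      \<and> (\<forall>k\<in>Mor shape. idc exA (F1 exF k) \<star>\<^bsub>exA\<^esub> mdf \<phi> (src shape k) = mdf \<phi> (trg shape k))"
      by (auto simp: \<phi>_def ncmpt_cone)
  qed (use cone in \<open>auto simp: \<phi>_def\<close>)
  moreover have "ndom (mdom \<phi>) = Delta0 shape exA obX" "ncod (mdom \<phi>) = exF"
    using cone by (auto simp: \<phi>_def two_cone_def)
  ultimately have "\<phi> \<in> Arr (hom_cat (functor_2cat shape exA) (Delta0 shape exA obX) exF)"
    by (simp add: hom_cat_def functor_2cat_def)
  with surj obtain \<alpha> where "\<alpha> \<in> Cell exA" "trg exA (dom2 exA \<alpha>) = obL"
      and \<phi>: "onArr (cone_functor shape exA exCone) \<alpha> = \<phi>"
    unfolding surjective_on_arrows_def by (auto simp: hom_cat_def)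
  then have "\<alpha> = idc exA (dom2 exA \<alpha>)" "dom2 exA \<alpha> \<in> Mor exA"
    using cell_into_L[of \<alpha>] by simp_all
  then have "cod2 exA \<alpha> = dom2 exA \<alpha>"
    by (metis exA.cell_simps(5))
  \<comment> \<open>The boundaries of an image are the cone precomposed with the boundaries of
    \<alpha>, which coincide for an identity.\<close>
  then have "mdom \<phi> = mcod \<phi>"
    unfolding \<phi>[symmetric] cone_functor_simps by simp
  then have "exMor gen_l0 \<odot>\<^bsub>exA\<^esub> exMor gen_f = exMor gen_l0 \<odot>\<^bsub>exA\<^esub> exMor gen_g"
    using ncmpt_cone[of gen_f FootL] ncmpt_cone[of gen_g FootL] by (simp add: \<phi>_def)
  \<comment> \<open>The two sides have invariants \<open>{gen_f}\<close> and
    \<open>{gen_g}\<close>.\<close>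
  from arg_cong[OF this, of mocc] show False by simp
qed

lemma is_iso_functor_imp_surjective_on_arrows:
  "is_iso_functor C D T \<Longrightarrow> surjective_on_arrows C D T"
  unfolding is_iso_functor_def surjective_on_arrows_def is_functor_def by metis

theorem mainTheorem2:
  shows "two_terminal (strict_slice shape exA exF) (obL, exCone)
    \<and> is_functor (hom_cat exA obX obL) (hom_cat (functor_2cat shape exA) (Delta0 shape exA obX) exF)
        (cone_functor shape exA exCone)
    \<and> \<not> surjective_on_arrows (hom_cat exA obX obL)
          (hom_cat (functor_2cat shape exA) (Delta0 shape exA obX) exF)
          (cone_functor shape exA exCone)
    \<and> \<not> is_two_limit shape exA exF obL exCone"
proof (intro conjI)
  \<comment> \<open>The 2-limit condition is instantiated at \<open>obX\<close>, where an
    isomorphism of categories would be surjective on arrows.\<close>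
  show "\<not> is_two_limit shape exA exF obL exCone"
    using not_surjective_cone_functor is_iso_functor_imp_surjective_on_arrows
    unfolding is_two_limit_def by (meson exA_Ob)
qed (rule two_terminal_exCone is_functor_cone_functor[OF two_cone_exCone]
      not_surjective_cone_functor)+

end
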